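(* Let $r\ge1$ and $\lambda\vdash r$. Then $$\sum_{|I|=r}\frac{\mathrm{Imm}_{\chi^\lambda}(X_I)}{\alpha(I)}=\frac{\mathrm{Imm}_{\chi^\lambda}(\Gamma_r)}{r!},$$ where the sum is over all non-decreasing multisets $I$ of $[m+n]$ of size $r$, the right-hand side is the classical immanant $\mathrm{Imm}_{\chi^\lambda}(M)=\sum_{\sigma\in\mathfrak{S}_r}\chi^\lambda(\sigma)\prod_{i=1}^rM_{i\sigma(i)}$ of a matrix with commuting entries, and $\Gamma_r$ is the $r\times r$ lower Hessenberg matrix with $(\Gamma_r)_{ij}=\gamma_{i-j+1}$ for $j\le i$, $(\Gamma_r)_{i,i+1}=i$, and $(\Gamma_r)_{ij}=0$ for $j>i+1$.
   Context: $\mathbb{C}^{m|n}$ has homogeneous basis $e_1,\ldots,e_{m+n}$, parity $\bar i=0$ for $i\le m$, $\bar i=1$ for $i>m$; $e_{ij}$ are matrix units of parity $\bar i+\bar j$. $\mathcal{A}$ is the free supercommutative $\mathbb{C}$-algebra on generators $x_{ij}$ of parity $\bar i+\bar j$; $X=\sum_{i,j}x_{ij}\otimes e_{ij}$. For $k\ge1$, $X_a=\sum_{i,j}x_{ij}\otimes1^{\otimes(a-1)}\otimes e_{ij}\otimes1^{\otimes(k-a)}\in\mathcal{A}\otimes\mathrm{End}(\mathbb{C}^{m|n})^{\otimes k}$ (graded tensor products, sign rule $(a\otimes b)(c\otimes d)=(-1)^{|b||c|}ac\otimes bd$). $\mathfrak{S}_k$ acts on $(\mathbb{C}^{m|n})^{\otimes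 k}$ by $\sigma\cdot(e_{i_1}\otimes\cdots\otimes e_{i_k})=(-1)^{\bar I_\sigma}e_{i_{\sigma^{-1}(1)}}\otimes\cdots\otimes e_{i_{\sigma^{-1}(k)}}$, $\bar I_\sigma=\sum_{p<q,\sigma(p)>\sigma(q)}\bar i_p\bar i_q$, extended to $\mathbb{C}[\mathfrak{S}_k]$ (even elements $1\otimes(\cdot)$); the transposition $(1\,2)$ acts on $(\mathbb{C}^{m|n})^{\otimes2}$ as $P=\sum_{i,j}(-1)^{\bar j}e_{ij}\otimes e_{ji}$. For even $T=\sum_{I,J}T^I_J\otimes e_{i_1j_1}\otimes\cdots\otimes e_{i_kj_k}$, $\langle I\mid T\mid J\rangle=(-1)^{\gamma(I,J)}T^I_J$, $\gamma(I,J)=\sum_a\bar i_a(\bar j_a+1)+\sum_{a<b}\bar j_b(\bar i_a+\bar j_a)$. Super-immanant: $\mathrm{Imm}_\chi(X_I)=(-1)^{\bar I}\langle I\mid\chi X_1\cdots X_k\mid I\rangle$ with $\bar I=\sum_p\bar i_p$ and the character $\chi$ identified with $\sum_\sigma\chi(\sigma)\sigma$; $\chi^\lambda$ is the irreducible character for $\lambda$. $\alpha(I)=\prod_i\alpha_i!$, $\alpha_i$ the multiplicity of $i$ in $I$. For even supermatrices $Y,Z\in\mathcal{A}\otimes\mathrm{End}(\mathbb{C}^{m|n})$, $Y*Z=\mathrm{str}_1(PY_1Z_2)$ with $Y_1=Y\otimes1$, $Z_2=1\otimes Z$ and $\mathrm{str}_1$ the partial supertrace ($\mathrm{str}(e_{ij})=\delta_{ij}(-1)^{\bar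 i}$) over the first factor; $X^{[1]}=X$, $X^{[k]}=X^{[k-1]}*X$, and $\gamma_k=\mathrm{str}\,X^{[k]}$. The $\gamma_k$ are even, hence lie in the commutative ring $\mathcal{A}_0$. *)

theory Defs
  imports Complex_Main "HOL-Library.Multiset" "HOL-Library.Product_Lexorder"
    "HOL-Library.Function_Algebras" "HOL-Library.FuncSet"
    "HOL-Combinatorics.Permutations"
begin

text \<open>Basis indices are 1..m+n; index i is odd iff i > m.\<close>
definition par :: "nat \<Rightarrow> nat \<Rightarrow> nat" where
  "par m i = (if m < i then 1 else 0)"

definition sgnc :: "nat \<Rightarrow> complex" where
  "sgnc k = (-1) ^ k"

text \<open>A generator is a pair (i,j). A monomial is a pair (E,O): a multiset E of
  even generators and a finite set O of odd generators; it stands for the product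
  of the even generators times the product of the odd generators in increasing
  (lexicographic) order. Elements of A are C-valued coefficient functions on monomials
  (elements built from generators have finite support).\<close>

type_synonym gen = "nat \<times> nat"
type_synonym mono = "gen multiset \<times> gen set"
type_synonym salg = "mono \<Rightarrow> complex"

text \<open>Sign of the product of the ordered odd monomials Q1 and Q2 (disjoint).\<close>
definition msign :: "gen set \<Rightarrow> gen set \<Rightarrow> complex" where
  "msign Q1 Q2 = sgnc (card {(a, b). a \<in> Q1 \<and> b \<in> Q2 \<and> b < a})"

definition amul :: "salg \<Rightarrow> salg \<Rightarrow> salg" where
  "amul f g = (\<lambda>(E, Q). \<Sum>E1\<in>{E1. E1 \<subseteq># E}. \<Sum>Q1\<in>Pow Q.
      msign Q1 (Q - Q1) * f (E1, Q1) * g (E - E1, Q - Q1))"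

definition ascal :: "complex \<Rightarrow> salg" where
  "ascal c = (\<lambda>M. if M = ({#}, {}) then c else 0)"

definition asmul :: "complex \<Rightarrow> salg \<Rightarrow> salg" where
  "asmul c f = (\<lambda>M. c * f M)"

definition pinv :: "nat \<Rightarrow> salg \<Rightarrow> salg" where
  "pinv k f = (\<lambda>(E, Q). (if even k then 1 else sgnc (card Q)) * f (E, Q))"

definition xgen :: "nat \<Rightarrow> nat \<Rightarrow> nat \<Rightarrow> salg" where
  "xgen m i j = (if even (par m i + par m j)
      then (\<lambda>M. if M = ({#(i, j)#}, {}) then 1 else 0)
      else (\<lambda>M. if M = ({#}, {(i, j)}) then 1 else 0))"

text \<open>An element T is represented by its coefficients T I J, i.e.
  T = \<Sum>_{I,J} T I J \<otimes> e_{i_1 j_1} \<otimes> ... \<otimes> e_{i_k j_k}, I, J lists of length k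
  with entries in 1..m+n (tensor positions are 0-indexed).\<close>

definition idx :: "nat \<Rightarrow> nat \<Rightarrow> nat list set" where
  "idx N k = {I. length I = k \<and> set I \<subseteq> {1..N}}"

definition edeg :: "nat \<Rightarrow> nat list \<Rightarrow> nat list \<Rightarrow> nat" where
  "edeg m I J = (\<Sum>p<length I. par m (I ! p) + par m (J ! p))"

text \<open>Graded product: (a \<otimes> u)(b \<otimes> v) = (-1)^{|u||b|} ab \<otimes> uv, and
  (u_1\<otimes>...\<otimes>u_k)(v_1\<otimes>...\<otimes>v_k) = (-1)^{\<Sum>_{q<p}|u_p||v_q|} u_1v_1 \<otimes>...\<otimes> u_kv_k.\<close>
definition tmul :: "nat \<Rightarrow> nat \<Rightarrow> nat \<Rightarrow> (nat list \<Rightarrow> nat list \<Rightarrow> salg)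
    \<Rightarrow> (nat list \<Rightarrow> nat list \<Rightarrow> salg) \<Rightarrow> (nat list \<Rightarrow> nat list \<Rightarrow> salg)" where
  "tmul m n k T S = (\<lambda>I L. \<Sum>J\<in>idx (m + n) k.
      asmul (sgnc (\<Sum>p<k. \<Sum>q<p. (par m (I ! p) + par m (J ! p)) * (par m (J ! q) + par m (L ! q))))
        (amul (T I J) (pinv (edeg m I J) (S J L))))"

definition tone :: "nat list \<Rightarrow> nat list \<Rightarrow> salg" where
  "tone I J = (if I = J then ascal 1 else 0)"

text \<open>X_a (position a, 0-indexed) = \<Sum> x_ij \<otimes> 1 \<otimes>..\<otimes> e_ij \<otimes>..\<otimes> 1.\<close>
definition Xa :: "nat \<Rightarrow> nat \<Rightarrow> nat \<Rightarrow> nat list \<Rightarrow> nat list \<Rightarrow> salg" where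
  "Xa m k a I J = (if (\<forall>b<k. b \<noteq> a \<longrightarrow> I ! b = J ! b) then xgen m (I ! a) (J ! a) else 0)"

definition Xprod :: "nat \<Rightarrow> nat \<Rightarrow> nat \<Rightarrow> nat list \<Rightarrow> nat list \<Rightarrow> salg" where
  "Xprod m n k = foldl (\<lambda>T a. tmul m n k T (Xa m k a)) tone [0..<k]"

text \<open>The sign \<bar>I\<bar>_\<sigma> for the action of \<sigma> on e_{i_1}\<otimes>...\<otimes>e_{i_k}.\<close>
definition permsgn :: "nat \<Rightarrow> nat \<Rightarrow> (nat \<Rightarrow> nat) \<Rightarrow> nat list \<Rightarrow> nat" where
  "permsgn m k \<sigma> J = (\<Sum>p<k. \<Sum>q<k. if p < q \<and> \<sigma> q < \<sigma> p then par m (J ! p) * par m (J ! q) else 0)"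

text \<open>The element 1 \<otimes> \<sigma> of A \<otimes> End(C^{m|n})^{\<otimes>k}, \<sigma> a permutation of the
  positions {0..<k}, expanded in matrix units. The operator of
  e_{i_1 j_1}\<otimes>...\<otimes>e_{i_k j_k} sends e_{j_1}\<otimes>...\<otimes>e_{j_k} to
  (-1)^{\<Sum>_{q<p}(i_p+j_p) j_q} e_{i_1}\<otimes>...\<otimes>e_{i_k} (and other basis tensors to 0),
  while \<sigma> sends e_J to (-1)^{J_\<sigma>} e_{j_{\<sigma>^{-1}(1)}}\<otimes>...; hence the coefficient below
  (this gives P = \<Sum>(-1)^{j} e_ij \<otimes> e_ji for k = 2).\<close>
definition permT :: "nat \<Rightarrow> nat \<Rightarrow> (nat \<Rightarrow> nat) \<Rightarrow> nat list \<Rightarrow> nat list \<Rightarrow> salg" where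
  "permT m k \<sigma> I J = (if I = map (\<lambda>p. J ! inv_into {0..<k} \<sigma> p) [0..<k]
      then ascal (sgnc ((\<Sum>p<k. \<Sum>q<p. (par m (I ! p) + par m (J ! p)) * par m (J ! q))
                        + permsgn m k \<sigma> J))
      else 0)"

definition gam :: "nat \<Rightarrow> nat list \<Rightarrow> nat list \<Rightarrow> nat" where
  "gam m I J = (\<Sum>a<length I. par m (I ! a) * (par m (J ! a) + 1))
     + (\<Sum>b<length I. \<Sum>a<b. par m (J ! b) * (par m (I ! a) + par m (J ! a)))"

definition is_partition :: "nat list \<Rightarrow> nat \<Rightarrow> bool" where
  "is_partition lam r \<longleftrightarrow> sorted_wrt (\<ge>) lam \<and> (\<forall>x\<in>set lam. 0 < x) \<and> sum_list lam = r"

text \<open>Permutation character of the Young subgroup S_\<mu> (number of \<mu>-tabloids,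
  i.e. maps f with fibre sizes \<mu>, fixed by \<sigma>); zero if some \<mu>_a < 0.\<close>
definition young_char :: "nat \<Rightarrow> int list \<Rightarrow> (nat \<Rightarrow> nat) \<Rightarrow> int" where
  "young_char r mu \<sigma> = (if (\<exists>x\<in>set mu. x < 0) then 0 else
     int (card {f \<in> {0..<r} \<rightarrow>\<^sub>E {0..<length mu}.
        (\<forall>a<length mu. card {p\<in>{0..<r}. f p = a} = nat (mu ! a)) \<and> (\<forall>p<r. f (\<sigma> p) = f p)}))"

text \<open>Irreducible character \<chi>^\<lambda> of S_r (acting on {0..<r}), via the
  Frobenius determinantal formula \<chi>^\<lambda> = det(\<xi>^{(\<lambda>_i - i + j)}).\<close>
definition irr_char :: "nat \<Rightarrow> nat list \<Rightarrow> (nat \<Rightarrow> nat) \<Rightarrow> int" where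
  "irr_char r lam \<sigma> = (\<Sum>w | w permutes {0..<length lam}.
      sign w * young_char r (map (\<lambda>i. int (lam ! i) - int i + int (w i)) [0..<length lam]) \<sigma>)"

definition chiT :: "nat \<Rightarrow> nat \<Rightarrow> nat list \<Rightarrow> nat list \<Rightarrow> nat list \<Rightarrow> salg" where
  "chiT m k lam = (\<lambda>I J. \<Sum>\<sigma> | \<sigma> permutes {0..<k}.
      asmul (of_int (irr_char k lam \<sigma>)) (permT m k \<sigma> I J))"

text \<open>Imm_{\<chi>^\<lambda>}(X_I) = (-1)^{\<bar>I\<bar>} \<langle>I| \<chi> X_1\<cdots>X_k |I\<rangle>, k = length I.\<close>
definition super_imm :: "nat \<Rightarrow> nat \<Rightarrow> nat list \<Rightarrow> nat list \<Rightarrow> salg" where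
  "super_imm m n lam I = (let k = length I in
     asmul (sgnc ((\<Sum>p<k. par m (I ! p)) + gam m I I))
       (tmul m n k (chiT m k lam) (Xprod m n k) I I))"

definition alpha :: "nat list \<Rightarrow> nat" where
  "alpha I = (\<Prod>i\<in>set I. fact (count (mset I) i))"

definition Xmat :: "nat \<Rightarrow> nat \<Rightarrow> nat \<Rightarrow> salg" where
  "Xmat m i j = xgen m i j"

text \<open>Y * Z = str_1(P Y_1 Z_2).\<close>
definition Pel :: "nat \<Rightarrow> nat list \<Rightarrow> nat list \<Rightarrow> salg" where
  "Pel m I J = (if I = [I ! 0, I ! 1] \<and> J = [I ! 1, I ! 0] then ascal (sgnc (par m (J ! 0))) else 0)"

definition star :: "nat \<Rightarrow> nat \<Rightarrow> (nat \<Rightarrow> nat \<Rightarrow> salg) \<Rightarrow> (nat \<Rightarrow> nat \<Rightarrow> salg)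
    \<Rightarrow> (nat \<Rightarrow> nat \<Rightarrow> salg)" where
  "star m n Y Z = (let
      Y1 = (\<lambda>I J. if I ! 1 = J ! 1 then Y (I ! 0) (J ! 0) else 0);
      Z2 = (\<lambda>I J. if I ! 0 = J ! 0 then Z (I ! 1) (J ! 1) else 0);
      T = tmul m n 2 (tmul m n 2 (Pel m) Y1) Z2
    in (\<lambda>i2 j2. \<Sum>i\<in>{1..m+n}. asmul (sgnc (par m i)) (T [i, i2] [i, j2])))"

fun Xpow :: "nat \<Rightarrow> nat \<Rightarrow> nat \<Rightarrow> nat \<Rightarrow> nat \<Rightarrow> salg" where
  "Xpow m n 0 = Xmat m"
| "Xpow m n (Suc 0) = Xmat m"
| "Xpow m n (Suc (Suc k)) = star m n (Xpow m n (Suc k)) (Xmat m)"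

definition gamma :: "nat \<Rightarrow> nat \<Rightarrow> nat \<Rightarrow> salg" where
  "gamma m n k = (\<Sum>i\<in>{1..m+n}. asmul (sgnc (par m i)) (Xpow m n k i i))"

text \<open>\<Gamma>_r with 0-indexed rows/columns (entries are even, hence commute).\<close>
definition Gam :: "nat \<Rightarrow> nat \<Rightarrow> nat \<Rightarrow> nat \<Rightarrow> salg" where
  "Gam m n i j = (if j \<le> i then gamma m n (i - j + 1)
                  else if j = i + 1 then ascal (of_nat (i + 1)) else 0)"

definition class_imm :: "nat \<Rightarrow> nat list \<Rightarrow> (nat \<Rightarrow> nat \<Rightarrow> salg) \<Rightarrow> salg" where
  "class_imm r lam M = (\<Sum>\<sigma> | \<sigma> permutes {0..<r}.
      asmul (of_int (irr_char r lam \<sigma>))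
        (foldl amul (ascal 1) (map (\<lambda>i. M i (\<sigma> i)) [0..<r])))"

end

(* Since X_1 ... X_r commutes with the symmetric group, Imm_chi(X_I) is symmetric in I, so the
   weighted sum over sorted I is 1/r! times the sum over all I, that is, 1/r! times the supertrace
   of chi X_1 ... X_r. The supertrace of sigma X_1 ... X_r is a class function of sigma.

   On the other side only permutations with sigma(i) <= i+1 contribute to Imm_chi(Gamma_r); their
   cycles are intervals. For any class function F, conjugating one row at a time reduces the sum of
   F over the whole symmetric group to a sum over the inverses of these permutations, each weighted
   by the product of the superdiagonal entries i that it meets. Splitting off the interval that
   contains the last position shows that the supertrace of such a permutation is the product of the
   gamma_k over its blocks, in path order. *)
theory Submission
  imports Defs "HOL-Combinatorics.Multiset_Permutations"
begin

text \<open>The obstacle is signs: odd matrix units and odd generators anticommute, so every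
  rearrangement must be tracked. The proof therefore avoids operator identities. Each column tuple
  \<open>J\<close> and permutation \<open>\<sigma>\<close> contribute one signed ordered monomial,
  \<open>perm_term\<close>, and commutation with the symmetric group becomes its invariance under
  relabelling all positions at once. For an adjacent transposition this exchanges two neighbouring
  generators, and the change of the exponent \<open>ordsgn\<close> is exactly their commutation
  sign. The superdiagonal entry \<open>i\<close> (row \<open>i - 1\<close>, column \<open>i\<close>
  when counted from 0) is a count: a permutation may send \<open>i\<close> to any of
  \<open>i\<close> smaller values, and conjugation makes all of them equivalent to
  \<open>i - 1\<close>. Inverses enter because \<open>perm_term\<close> pairs position
  \<open>p\<close> with \<open>inv \<sigma> p\<close>: the generators of a block follow a closed
  path in the order of the star powers when the inverse climbs, that is, when
  \<open>\<sigma>\<close> descends.\<close>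

section \<open>The supercommutative algebra\<close>

lemma sum_salg_apply: "(\<Sum>a\<in>A. f a) x = (\<Sum>a\<in>A. (f a :: salg) x)"
  by (induction A rule: infinite_finite_induct) auto

lemma sgnc_add: "sgnc (a + b) = sgnc a * sgnc b"
  by (simp add: sgnc_def power_add)

lemma sgnc_eqI: "even (a + b) \<Longrightarrow> sgnc a = sgnc b"
  by (cases "even a") (auto simp: sgnc_def)

lemma sgnc_even: "even a \<Longrightarrow> sgnc a = 1"
  by (simp add: sgnc_def)

lemma sgnc_square [simp]: "sgnc a * sgnc a = 1" "sgnc a * (sgnc a * x) = x"
  by (cases "even a"; simp add: sgnc_def)+

lemma sgnc_0 [simp]: "sgnc 0 = 1"
  by (simp add: sgnc_def)

lemma asmul_simps [simp]:
  "asmul 1 f = f" "asmul 0 f = 0" "asmul c 0 = 0"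
  "asmul c (asmul d f) = asmul (c * d) f"
  by (auto simp: asmul_def fun_eq_iff)

lemma asmul_apply: "asmul c f M = c * f M"
  by (simp add: asmul_def)

lemma asmul_sum: "asmul c (\<Sum>a\<in>A. f a) = (\<Sum>a\<in>A. asmul c (f a))"
  by (auto simp: fun_eq_iff asmul_apply sum_salg_apply sum_distrib_left)

lemma amul_apply:
  "amul f g (E, Q) = (\<Sum>E1\<in>{E1. E1 \<subseteq># E}. \<Sum>Q1\<in>Pow Q.
      msign Q1 (Q - Q1) * f (E1, Q1) * g (E - E1, Q - Q1))"
  by (simp add: amul_def)

text \<open>For infinite \<open>Q\<close> the index set \<open>Pow Q\<close> is infinite, and sums
  over infinite sets are 0 by convention.\<close>

lemma amul_infinite: "infinite Q \<Longrightarrow> amul f g (E, Q) = 0"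
  by (simp add: amul_def)

lemma amul_sum_left: "amul (\<Sum>a\<in>A. f a) g = (\<Sum>a\<in>A. amul (f a) g)"
proof (intro ext, clarify)
  fix E Q
  show "amul (\<Sum>a\<in>A. f a) g (E, Q) = (\<Sum>a\<in>A. amul (f a) g) (E, Q)"
    unfolding amul_apply sum_salg_apply
    by (simp add: sum_distrib_left sum_distrib_right sum.swap[of _ A])
qed

lemma amul_sum_right: "amul f (\<Sum>a\<in>A. g a) = (\<Sum>a\<in>A. amul f (g a))"
proof (intro ext, clarify)
  fix E Q
  show "amul f (\<Sum>a\<in>A. g a) (E, Q) = (\<Sum>a\<in>A. amul f (g a)) (E, Q)"
    unfolding amul_apply sum_salg_apply
    by (simp add: sum_distrib_left sum_distrib_right sum.swap[of _ A])
qed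

lemma amul_asmul [simp]:
  "amul (asmul c f) g = asmul c (amul f g)" "amul f (asmul c g) = asmul c (amul f g)"
  by (auto simp: fun_eq_iff amul_apply asmul_apply sum_distrib_left mult_ac)

lemma amul_0 [simp]: "amul 0 g = 0" "amul f 0 = 0"
  by (auto simp: fun_eq_iff amul_apply)

lemma finite_submultisets: "finite {F. F \<subseteq># (E :: 'a multiset)}"
proof (rule finite_subset)
  have "F \<in> (\<lambda>xs. mset xs) ` {xs. set xs \<subseteq> set_mset E \<and> length xs \<le> size E}" if "F \<subseteq># E" for F
  proof -
    obtain xs where "mset xs = F" using ex_mset by blast
    then show ?thesis
      using set_mset_mono[OF that] size_mset_mono[OF that] by (intro image_eqI[of _ _ xs]) auto
  qed
  then show "{F. F \<subseteq># E} \<subseteq> (\<lambda>xs. mset xs) ` {xs. set xs \<subseteq> set_mset E \<and> length xs \<le> size E}"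
    by blast
qed (simp add: finite_lists_length_le)

lemma sum_sum_delta:
  assumes "finite A" "finite B"
  shows "(\<Sum>x\<in>A. \<Sum>y\<in>B. if x = a \<and> y = b then c else 0) = (if a \<in> A \<and> b \<in> B then c else 0)"
proof -
  have "(\<Sum>x\<in>A. \<Sum>y\<in>B. if x = a \<and> y = b then c else 0) = (\<Sum>x\<in>A. if x = a then if b \<in> B then c else 0 else 0)"
    using assms by (intro sum.cong) (auto simp: sum.delta)
  then show ?thesis using assms by (simp add: sum.delta)
qed

lemma msign_Un_left:
  assumes "finite A" "finite B" "finite C" "A \<inter> B = {}"
  shows "msign (A \<union> B) C = msign A C * msign B C"
proof -
  have "{(a, b). a \<in> A \<union> B \<and> b \<in> C \<and> b < a} =
      {(a, b). a \<in> A \<and> b \<in> C \<and> b < a} \<union> {(a, b). a \<in> B \<and> b \<in> C \<and> b < a}"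
    by auto
  moreover have "finite {(a, b). a \<in> A \<and> b \<in> C \<and> b < a}"
    by (rule finite_subset[of _ "A \<times> C"]) (use assms in auto)
  moreover have "finite {(a, b). a \<in> B \<and> b \<in> C \<and> b < a}"
    by (rule finite_subset[of _ "B \<times> C"]) (use assms in auto)
  ultimately show ?thesis
    using assms(4) unfolding msign_def
    by (subst sgnc_add[symmetric]) (auto intro!: arg_cong[of _ _ sgnc] card_Un_disjoint)
qed

lemma msign_Un_right:
  assumes "finite A" "finite B" "finite C" "B \<inter> C = {}"
  shows "msign A (B \<union> C) = msign A B * msign A C"
proof -
  have "{(a, b). a \<in> A \<and> b \<in> B \<union> C \<and> b < a} =
      {(a, b). a \<in> A \<and> b \<in> B \<and> b < a} \<union> {(a, b). a \<in> A \<and> b \<in> C \<and> b < a}"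
    by auto
  moreover have "finite {(a, b). a \<in> A \<and> b \<in> B \<and> b < a}"
    by (rule finite_subset[of _ "A \<times> B"]) (use assms in auto)
  moreover have "finite {(a, b). a \<in> A \<and> b \<in> C \<and> b < a}"
    by (rule finite_subset[of _ "A \<times> C"]) (use assms in auto)
  ultimately show ?thesis
    using assms(4) unfolding msign_def
    by (subst sgnc_add[symmetric]) (auto intro!: arg_cong[of _ _ sgnc] card_Un_disjoint)
qed

text \<open>A chain \<open>G \<subseteq># F \<subseteq># E\<close> amounts to \<open>G\<close>
  together with the layer \<open>F - G\<close>; this rebrackets the double sum in
  \<open>amul_assoc\<close>.\<close>

lemma sum_submultiset_chains:
  fixes E :: "'a multiset"
  shows "(\<Sum>F\<in>{F. F \<subseteq># E}. \<Sum>G\<in>{G. G \<subseteq># F}. \<phi> G F) =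
    (\<Sum>G\<in>{G. G \<subseteq># E}. \<Sum>H\<in>{H. H \<subseteq># E - G}. \<phi> G (G + H))"
proof -
  have 1: "G + H \<subseteq># E" if "G \<subseteq># E" "H \<subseteq># E - G" for G H
    using that by (metis subset_mset.add_left_mono subset_mset.add_diff_inverse)
  have 2: "F - G \<subseteq># E - G" "G \<subseteq># E" "G + (F - G) = F" if "F \<subseteq># E" "G \<subseteq># F" for F G
    using that by (auto intro: subset_mset.order_trans simp: subset_eq_diff_conv)
  show ?thesis
    by (simp add: sum.Sigma finite_submultisets,
      rule sum.reindex_bij_witness[where i = "\<lambda>(G, H). (G + H, G)" and j = "\<lambda>(F, G). (G, F - G)"])
     (auto simp: 1 2)
qed

lemma sum_subset_chains:
  assumes "finite Q"
  shows "(\<Sum>F\<in>Pow Q. \<Sum>G\<in>Pow F. \<phi> G F) = (\<Sum>G\<in>Pow Q. \<Sum>H\<in>Pow (Q - G). \<phi> G (G \<union> H))"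
  using assms
  by (subst (1 2) sum.Sigma, auto intro: finite_subset,
      intro sum.reindex_bij_witness[where i = "\<lambda>(G, H). (G \<union> H, G)" and j = "\<lambda>(F, G). (G, F - G)"])
     (auto simp: Un_absorb1 Un_Diff)

text \<open>Both sides run over the decompositions of the monomial \<open>(E, Q)\<close> into three
  parts, and the signs agree since \<open>msign\<close> is multiplicative over disjoint unions in
  either argument.\<close>

lemma amul_assoc: "amul (amul f g) h = amul f (amul g h)"
proof (intro ext, clarify)
  fix E and Q :: "gen set"
  show "amul (amul f g) h (E, Q) = amul f (amul g h) (E, Q)"
  proof (cases "finite Q")
    case True
    define T where "T = (\<lambda>E1 E2 Q1 Q2. msign Q1 (Q - Q1) * msign Q2 (Q - Q1 - Q2) * f (E1, Q1) *
      g (E2, Q2) * h (E - E1 - E2, Q - Q1 - Q2))"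
    have sgn: "msign (Q1 \<union> Q2) (Q - (Q1 \<union> Q2)) * msign Q1 Q2 = msign Q1 (Q - Q1) * msign Q2 (Q - Q1 - Q2)"
      if "Q1 \<subseteq> Q" "Q2 \<subseteq> Q - Q1" for Q1 Q2
    proof -
      have fin: "finite Q1" "finite Q2" "finite (Q - Q1 - Q2)"
        using that True by (auto intro: finite_subset)
      have "msign Q1 (Q2 \<union> (Q - Q1 - Q2)) = msign Q1 Q2 * msign Q1 (Q - Q1 - Q2)"
        by (intro msign_Un_right) (use fin in auto)
      moreover have "Q2 \<union> (Q - Q1 - Q2) = Q - Q1" using that by auto
      moreover have "msign (Q1 \<union> Q2) (Q - Q1 - Q2) = msign Q1 (Q - Q1 - Q2) * msign Q2 (Q - Q1 - Q2)"
        by (intro msign_Un_left) (use fin that in auto)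
      ultimately show ?thesis by (simp add: Diff_eq Int_ac)
    qed
    have "amul (amul f g) h (E, Q) = (\<Sum>F\<in>{F. F \<subseteq># E}. \<Sum>E1\<in>{E1. E1 \<subseteq># F}. \<Sum>R\<in>Pow Q. \<Sum>Q1\<in>Pow R.
        msign R (Q - R) * msign Q1 (R - Q1) * f (E1, Q1) * g (F - E1, R - Q1) * h (E - F, Q - R))"
      unfolding amul_apply
      by (subst sum.swap) (simp add: sum_distrib_left sum_distrib_right mult_ac)
    also have "\<dots> = (\<Sum>E1\<in>{F. F \<subseteq># E}. \<Sum>E2\<in>{E2. E2 \<subseteq># E - E1}. \<Sum>Q1\<in>Pow Q. \<Sum>Q2\<in>Pow (Q - Q1).
        msign (Q1 \<union> Q2) (Q - (Q1 \<union> Q2)) * msign Q1 (Q1 \<union> Q2 - Q1) * f (E1, Q1) *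
        g (E1 + E2 - E1, Q1 \<union> Q2 - Q1) * h (E - (E1 + E2), Q - (Q1 \<union> Q2)))"
      by (subst sum_submultiset_chains, subst sum_subset_chains[OF True]) simp
    also have "\<dots> = (\<Sum>E1\<in>{F. F \<subseteq># E}. \<Sum>E2\<in>{E2. E2 \<subseteq># E - E1}. \<Sum>Q1\<in>Pow Q. \<Sum>Q2\<in>Pow (Q - Q1).
        T E1 E2 Q1 Q2)"
    proof (intro sum.cong refl)
      fix E1 E2 Q1 Q2 assume "Q1 \<in> Pow Q" "Q2 \<in> Pow (Q - Q1)"
      moreover from this have "Q1 \<union> Q2 - Q1 = Q2" "Q - (Q1 \<union> Q2) = Q - Q1 - Q2" by auto
      ultimately show "msign (Q1 \<union> Q2) (Q - (Q1 \<union> Q2)) * msign Q1 (Q1 \<union> Q2 - Q1) * f (E1, Q1) *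
        g (E1 + E2 - E1, Q1 \<union> Q2 - Q1) * h (E - (E1 + E2), Q - (Q1 \<union> Q2)) = T E1 E2 Q1 Q2"
        using sgn[of Q1 Q2] unfolding T_def by simp
    qed
    also have "\<dots> = amul f (amul g h) (E, Q)"
      unfolding amul_apply T_def
      by (simp add: sum_distrib_left mult_ac, intro sum.cong refl, rule sum.swap)
    finally show ?thesis .
  qed (simp add: amul_infinite)
qed

section \<open>Monomials and the commutation of generators\<close>

definition mono_elt :: "gen multiset \<Rightarrow> gen set \<Rightarrow> salg" where
  "mono_elt E Q = (\<lambda>M. if M = (E, Q) then 1 else 0)"

lemma amul_mono_elt:
  assumes "finite Q1" "finite Q2"
  shows "amul (mono_elt E1 Q1) (mono_elt E2 Q2) =
    (if Q1 \<inter> Q2 = {} then asmul (msign Q1 Q2) (mono_elt (E1 + E2) (Q1 \<union> Q2)) else 0)"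
proof (intro ext, clarify)
  fix E and Q :: "gen set"
  have "amul (mono_elt E1 Q1) (mono_elt E2 Q2) (E, Q) =
    (\<Sum>F\<in>{F. F \<subseteq># E}. \<Sum>R\<in>Pow Q. if F = E1 \<and> R = Q1 then
      (if E = E1 + E2 \<and> Q = Q1 \<union> Q2 \<and> Q1 \<inter> Q2 = {} then msign Q1 Q2 else 0) else 0)"
    unfolding amul_apply mono_elt_def
  proof (intro sum.cong refl)
    fix F R assume "F \<in> {F. F \<subseteq># E}" "R \<in> Pow Q"
    then have "E - F = E2 \<longleftrightarrow> E = F + E2" "Q - R = Q2 \<longleftrightarrow> Q = R \<union> Q2 \<and> R \<inter> Q2 = {}"
      by auto
    moreover have "R \<inter> Q2 = {} \<Longrightarrow> R \<union> Q2 - R = Q2" by auto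
    ultimately show "msign R (Q - R) * (if (F, R) = (E1, Q1) then 1 else 0) *
        (if (E - F, Q - R) = (E2, Q2) then 1 else 0) = (if F = E1 \<and> R = Q1 then
      (if E = E1 + E2 \<and> Q = Q1 \<union> Q2 \<and> Q1 \<inter> Q2 = {} then msign Q1 Q2 else 0) else 0)"
      by (cases "F = E1"; cases "R = Q1") simp_all
  qed
  also have "\<dots> = (if Q1 \<inter> Q2 = {} then asmul (msign Q1 Q2) (mono_elt (E1 + E2) (Q1 \<union> Q2)) else 0) (E, Q)"
  proof (cases "finite Q")
    case True
    then show ?thesis by (simp add: sum_sum_delta finite_submultisets) (auto simp: mono_elt_def asmul_apply)
  next
    case False
    then show ?thesis using assms by (auto simp: mono_elt_def asmul_apply)
  qed
  finally show "amul (mono_elt E1 Q1) (mono_elt E2 Q2) (E, Q) = \<dots>" .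
qed

lemma msign_empty [simp]: "msign {} Q = 1" "msign Q {} = 1"
  by (simp_all add: msign_def)

lemma ascal_eq_asmul: "ascal c = asmul c (ascal 1)"
  by (simp add: ascal_def asmul_def fun_eq_iff)

lemma xgen_mono_elt:
  "xgen m i j = (if even (par m i + par m j) then mono_elt {#(i, j)#} {} else mono_elt {#} {(i, j)})"
  by (simp add: xgen_def mono_elt_def)

lemma msign_singletons: "msign {a} {b} = (if b < a then -1 else 1)"
proof -
  have "{(x, y). x \<in> {a} \<and> y \<in> {b} \<and> y < x} = (if b < a then {(a, b)} else {})" by auto
  then show ?thesis by (simp add: msign_def sgnc_def)
qed

text \<open>An even generator causes no sign; for two odd ones the sign is the single inversion
  counted by \<open>msign_singletons\<close>. Two equal odd generators give 0 on both sides.\<close>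

lemma xgen_commute:
  "amul (xgen m i j) (xgen m k l) =
    asmul (sgnc ((par m i + par m j) * (par m k + par m l))) (amul (xgen m k l) (xgen m i j))"
proof (cases "even (par m i + par m j) \<or> even (par m k + par m l)")
  case True
  then have "sgnc ((par m i + par m j) * (par m k + par m l)) = 1"
    by (intro sgnc_even) simp
  moreover obtain p q where "p \<or> q"
    "xgen m i j = (if p then mono_elt {#(i, j)#} {} else mono_elt {#} {(i, j)})"
    "xgen m k l = (if q then mono_elt {#(k, l)#} {} else mono_elt {#} {(k, l)})"
    using True xgen_mono_elt by blast
  ultimately show ?thesis
    by (cases p; cases q; simp add: amul_mono_elt add_mset_commute)
next
  case False
  then have "sgnc ((par m i + par m j) * (par m k + par m l)) = -1"
    by (simp add: sgnc_def)
  moreover have "xgen m i j = mono_elt {#} {(i, j)}" "xgen m k l = mono_elt {#} {(k, l)}"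
    using False by (simp_all only: xgen_mono_elt de_Morgan_disj if_False)
  ultimately show ?thesis
    by (auto simp: amul_mono_elt msign_singletons insert_commute)
qed

text \<open>\<^const>\<open>amul\<close> vanishes on infinite sets of odd generators, so \<^term>\<open>ascal 1\<close> is a
  unit only for such coefficient functions.\<close>
definition fin_odd :: "salg \<Rightarrow> bool" where
  "fin_odd f \<longleftrightarrow> (\<forall>E Q. infinite Q \<longrightarrow> f (E, Q) = 0)"

lemma fin_odd_intros [intro, simp]:
  "fin_odd (amul f g)" "fin_odd (ascal c)" "fin_odd (xgen m i j)"
  by (auto simp: fin_odd_def amul_infinite ascal_def xgen_def)

lemma amul_ascal_left:
  assumes "fin_odd f" shows "amul (ascal 1) f = f"
proof (intro ext, clarify)
  fix E and Q :: "gen set"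
  show "amul (ascal 1) f (E, Q) = f (E, Q)"
  proof (cases "finite Q")
    case True
    have "amul (ascal 1) f (E, Q) =
      (\<Sum>F\<in>{F. F \<subseteq># E}. \<Sum>R\<in>Pow Q. if F = {#} \<and> R = {} then f (E, Q) else 0)"
      unfolding amul_apply ascal_def by (intro sum.cong refl) auto
    then show ?thesis using True by (simp add: sum_sum_delta finite_submultisets)
  qed (use assms in \<open>auto simp: fin_odd_def amul_infinite\<close>)
qed

lemma amul_ascal_right:
  assumes "fin_odd f" shows "amul f (ascal 1) = f"
proof (intro ext, clarify)
  fix E and Q :: "gen set"
  show "amul f (ascal 1) (E, Q) = f (E, Q)"
  proof (cases "finite Q")
    case True
    have "amul f (ascal 1) (E, Q) =
      (\<Sum>F\<in>{F. F \<subseteq># E}. \<Sum>R\<in>Pow Q. if F = E \<and> R = Q then f (E, Q) else 0)"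
      unfolding amul_apply ascal_def
      by (intro sum.cong refl) (auto simp: Diff_eq_empty_iff_mset subset_mset.antisym)
    then show ?thesis using True by (simp add: sum_sum_delta finite_submultisets)
  qed (use assms in \<open>auto simp: fin_odd_def amul_infinite\<close>)
qed

section \<open>Ordered products\<close>

definition aprod :: "salg list \<Rightarrow> salg" where
  "aprod = foldl amul (ascal 1)"

lemma aprod_Nil [simp]: "aprod [] = ascal 1"
  by (simp add: aprod_def)

lemma aprod_snoc: "aprod (xs @ [x]) = amul (aprod xs) x"
  by (simp add: aprod_def)

lemma fin_odd_aprod [simp]: "fin_odd (aprod xs)"
  by (cases xs rule: rev_cases) (auto simp: aprod_snoc)

lemma aprod_append: "aprod (xs @ ys) = amul (aprod xs) (aprod ys)"
proof (induction ys rule: rev_induct)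
  case (snoc y ys)
  then show ?case using aprod_snoc[of "xs @ ys" y] by (simp add: aprod_snoc amul_assoc)
qed (simp add: amul_ascal_right)

lemma aprod_singleton: "fin_odd x \<Longrightarrow> aprod [x] = x"
  using aprod_snoc[of "[]" x] by (simp add: amul_ascal_left)

lemma pinv_simps:
  "even k \<Longrightarrow> pinv k f = f" "pinv k 0 = 0"
  "pinv k (xgen m i j) = asmul (sgnc (k * (par m i + par m j))) (xgen m i j)"
  by (auto simp: pinv_def xgen_def asmul_def fun_eq_iff sgnc_def)

section \<open>Class functions and Hessenberg permutations\<close>

text \<open>Rows are straightened from the last one downwards: among the permutations with
  \<open>\<sigma> j = v < j\<close>, conjugation by the transposition of \<open>v\<close> and \<open>j - 1\<close> makes all values of \<open>v\<close>
  equivalent to \<open>v = j - 1\<close>, which contributes the factor \<open>j\<close>.\<close>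
lemma sum_permutes_hessenberg:
  fixes F :: "(nat \<Rightarrow> nat) \<Rightarrow> 'a::comm_semiring_1"
  assumes conj: "\<And>\<sigma> a b. \<sigma> permutes {..<r} \<Longrightarrow> a < r \<Longrightarrow> b < r \<Longrightarrow>
    F (transpose a b \<circ> \<sigma> \<circ> transpose a b) = F \<sigma>"
  shows "(\<Sum>\<sigma> | \<sigma> permutes {..<r}. F \<sigma>) =
    (\<Sum>\<sigma> | \<sigma> permutes {..<r} \<and> (\<forall>i<r. i \<le> Suc (\<sigma> i)). of_nat (\<Prod>i | i < r \<and> \<sigma> i < i. i) * F \<sigma>)"
proof -
  define P where "P j = {\<sigma>. \<sigma> permutes {..<r} \<and> (\<forall>i<r. j \<le> i \<longrightarrow> i \<le> Suc (\<sigma> i))}" for j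
  define W where "W j \<sigma> = (\<Prod>i | j \<le> i \<and> i < r \<and> \<sigma> i < i. i)" for j and \<sigma> :: "nat \<Rightarrow> nat"
  define g where "g j \<sigma> = of_nat (W j \<sigma>) * F \<sigma>" for j \<sigma>
  have finP: "finite (P j)" for j
    unfolding P_def by (rule finite_subset[OF _ finite_permutations[of "{..<r}"]]) auto
  have step: "sum (g (Suc j)) (P (Suc j)) = sum (g j) (P j)" if j: "j < r" for j
  proof -
    define A where "A = {\<sigma> \<in> P (Suc j). j \<le> \<sigma> j}"
    define B where "B v = {\<sigma> \<in> P (Suc j). \<sigma> j = v}" for v
    have WA: "W j \<sigma> = W (Suc j) \<sigma>" if "\<sigma> \<in> A" for \<sigma>
      unfolding W_def using that by (intro prod.cong) (auto simp: A_def Suc_le_eq le_less)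
    have WB: "W j \<sigma> = j * W (Suc j) \<sigma>" if "\<sigma> \<in> B v" "v < j" for \<sigma> v
    proof -
      have "{i. j \<le> i \<and> i < r \<and> \<sigma> i < i} = insert j {i. Suc j \<le> i \<and> i < r \<and> \<sigma> i < i}"
        using that j by (auto simp: B_def le_less)
      then show ?thesis by (simp add: W_def)
    qed
    have finAB: "finite A" "finite (B v)" for v
      using finP by (simp_all add: A_def B_def)
    have "P (Suc j) = A \<union> (\<Union>v\<in>{..<j}. B v)"
      by (auto simp: A_def B_def)
    then have "sum (g (Suc j)) (P (Suc j)) = sum (g (Suc j)) A + (\<Sum>v<j. sum (g (Suc j)) (B v))"
    proof (simp only:, subst sum.union_disjoint)
      show "A \<inter> (\<Union>v\<in>{..<j}. B v) = {}" by (auto simp: A_def B_def)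
      have "sum (g (Suc j)) (\<Union>v\<in>{..<j}. B v) = (\<Sum>v<j. sum (g (Suc j)) (B v))"
        by (rule sum.UNION_disjoint) (use finAB in \<open>auto simp: B_def\<close>)
      then show "sum (g (Suc j)) A + sum (g (Suc j)) (\<Union>v\<in>{..<j}. B v) =
        sum (g (Suc j)) A + (\<Sum>v<j. sum (g (Suc j)) (B v))" by simp
    qed (use finAB in auto)
    also have "\<dots> = sum (g j) (P j)"
    proof (cases j)
      case 0
      have "P 0 = A" by (auto simp: P_def A_def 0 Suc_le_eq)
      then show ?thesis using WA 0 by (auto simp: g_def intro!: sum.cong)
    next
      case (Suc k)
      have Pj: "P j = A \<union> B k"
      proof -
        have "\<sigma> \<in> P j \<longleftrightarrow> \<sigma> \<in> P (Suc j) \<and> j \<le> Suc (\<sigma> j)" for \<sigma>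
          unfolding P_def mem_Collect_eq using j by (metis le_less Suc_le_eq)
        moreover have "j \<le> Suc (\<sigma> j) \<longleftrightarrow> j \<le> \<sigma> j \<or> \<sigma> j = k" for \<sigma> :: "nat \<Rightarrow> nat"
          unfolding Suc by arith
        ultimately show ?thesis unfolding A_def B_def by blast
      qed
      have eq: "sum (g (Suc j)) (B v) = sum (g (Suc j)) (B k)" if v: "v < j" for v
      proof -
        define t where "t = transpose v k"
        have t: "t permutes {..<r}" "\<And>i. i \<ge> j \<Longrightarrow> t i = i" "t \<circ> t = id" "t v = k" "t k = v"
            "\<And>i. t i < j \<longleftrightarrow> i < j" "\<And>x. t (t x) = x"
          using v j by (auto simp: t_def Suc transpose_def intro!: permutes_swap_id)
        have tge: "t i = i" if "\<not> i < j" for i using t(2)[of i] that by auto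
        define c where "c \<sigma> = t \<circ> \<sigma> \<circ> t" for \<sigma> :: "nat \<Rightarrow> nat"
        have cP: "c \<sigma> \<in> P (Suc j)" if "\<sigma> \<in> P (Suc j)" for \<sigma>
        proof -
          \<comment> \<open>In a row \<open>i > j\<close> the condition gives
            \<open>\<sigma> i \<ge> j\<close>, and \<open>t\<close> moves only values below
            \<open>j\<close>.\<close>
          have "i \<le> Suc (t (\<sigma> i))" if "i < r" "Suc j \<le> i" for i
          proof -
            have "i \<le> Suc (\<sigma> i)" using \<open>\<sigma> \<in> P (Suc j)\<close> that by (auto simp: P_def)
            then show ?thesis using that t(2)[of "\<sigma> i"] by auto
          qed
          then show ?thesis
            using that t by (auto simp: P_def c_def intro!: permutes_compose)
        qed
        have cg: "g (Suc j) (c \<sigma>) = g (Suc j) \<sigma>" if "\<sigma> \<in> P (Suc j)" for \<sigma>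
        proof -
          have "t (\<sigma> (t i)) < i \<longleftrightarrow> \<sigma> i < i" if "Suc j \<le> i" for i
            using t(2)[of i] t(6)[of "\<sigma> i"] t(2)[of "\<sigma> i"] that
            by (cases "\<sigma> i < j") auto
          then have "W (Suc j) (c \<sigma>) = W (Suc j) \<sigma>"
            unfolding W_def c_def by (intro prod.cong) auto
          moreover have "F (c \<sigma>) = F \<sigma>"
            unfolding c_def t_def by (rule conj) (use that v j Suc in \<open>auto simp: P_def\<close>)
          ultimately show ?thesis by (simp add: g_def)
        qed
        have cc: "c (c \<sigma>) = \<sigma>" for \<sigma> by (simp add: c_def fun_eq_iff t)
        have cj: "c \<sigma> j = t (\<sigma> j)" for \<sigma> by (simp add: c_def t)
        show ?thesis
          by (rule sum.reindex_bij_witness[where i = c and j = c])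
             (auto simp: cc B_def cP cg cj t)
      qed
      have "sum (g j) (P j) = sum (g j) A + sum (g j) (B k)"
        unfolding Pj using finAB by (intro sum.union_disjoint) (auto simp: A_def B_def Suc)
      also have "sum (g j) A = sum (g (Suc j)) A"
        by (intro sum.cong) (auto simp: g_def WA)
      \<comment> \<open>The weight \<open>j\<close> is spread over the \<open>j\<close> possible
        values \<open>v < j\<close>.\<close>
      also have "sum (g j) (B k) = (\<Sum>v<j. sum (g (Suc j)) (B k))"
      proof -
        have "g j \<sigma> = of_nat j * g (Suc j) \<sigma>" if "\<sigma> \<in> B k" for \<sigma>
          using WB[OF that] Suc by (simp only: g_def of_nat_mult mult.assoc lessI)
        then have "sum (g j) (B k) = (\<Sum>\<sigma>\<in>B k. of_nat j * g (Suc j) \<sigma>)"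
          by (intro sum.cong) auto
        then show ?thesis by (simp add: sum_distrib_left)
      qed
      also have "\<dots> = (\<Sum>v<j. sum (g (Suc j)) (B v))"
        by (intro sum.cong refl eq[symmetric]) simp
      finally show ?thesis ..
    qed
    finally show ?thesis .
  qed
  have "sum (g r) (P r) = sum (g (r - d)) (P (r - d))" if "d \<le> r" for d
    using that
  proof (induction d)
    case (Suc d)
    then show ?case using step[of "r - Suc d"] by (simp add: Suc_diff_Suc)
  qed simp
  from this[of r] have "sum (g r) (P r) = sum (g 0) (P 0)" by simp
  moreover have "W r \<sigma> = 1" for \<sigma>
    unfolding W_def by (rule prod.neutral) auto
  ultimately show ?thesis
    by (simp add: g_def P_def) (simp add: W_def)
qed

subsection \<open>Parity of the sign exponents\<close>

text \<open>The graded sign rule produces exponents summed over pairs of tensor positions, with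
  \<open>q\<close> to the left of \<open>p\<close>.\<close>

definition tri :: "nat \<Rightarrow> (nat \<Rightarrow> nat \<Rightarrow> nat) \<Rightarrow> nat" where
  "tri r f = (\<Sum>p<r. \<Sum>q<p. f p q)"

lemma tri_pairs: "tri r f = (\<Sum>(p, q)\<in>{(p, q). q < p \<and> p < r}. f p q)"
  unfolding tri_def by (subst sum.Sigma) (auto intro!: sum.cong)

lemma finite_tri_pairs: "finite {(p, q). q < p \<and> p < (r :: nat)}"
  by (rule finite_subset[of _ "{..<r} \<times> {..<r}"]) auto

text \<open>An adjacent transposition permutes the pairs \<open>q < p\<close> except
  \<open>(Suc a, a)\<close>, whose order it reverses. The correction stands on both sides because
  the values are natural numbers.\<close>

lemma tri_adjacent_swap:
  assumes "Suc a < r"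
  defines "t \<equiv> transpose a (Suc a)"
  shows "tri r (\<lambda>p q. f (t p) (t q)) + f (Suc a) a = tri r f + f a (Suc a)"
proof -
  let ?S = "{(p, q). q < p \<and> p < r} - {(Suc a, a)}"
  have t: "t a = Suc a" "t (Suc a) = a" "\<And>x. t (t x) = x" by (auto simp: t_def)
  have mem: "(Suc a, a) \<in> {(p, q). q < p \<and> p < r}" using assms by simp
  have key: "t q < t p \<and> t p < r \<and> \<not> (t p = Suc a \<and> t q = a)"
    if "q < p" "p < r" "\<not> (p = Suc a \<and> q = a)" for p q
    using that assms(1) unfolding t_def transpose_def by (auto split: if_splits)
  have "(\<Sum>(p, q)\<in>?S. f (t p) (t q)) = (\<Sum>(p, q)\<in>?S. f p q)"
    by (rule sum.reindex_bij_witness[where i = "\<lambda>(p, q). (t p, t q)" and j = "\<lambda>(p, q). (t p, t q)"])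
       (use key in \<open>auto simp: t(3)\<close>)
  then show ?thesis
    unfolding tri_pairs by (simp add: sum.remove[OF finite_tri_pairs mem] t)
qed

text \<open>Inversions of a permutation correspond to inversions of its inverse. Passing to the
  inverse turns a left factor of \<open>\<pi>\<close> into a change of positions, which
  \<open>tri_adjacent_swap\<close> can handle.\<close>

lemma tri_inversions:
  assumes "\<pi> permutes {..<r}"
  shows "tri r (\<lambda>p q. if \<pi> p < \<pi> q then j p * j q else 0) =
    tri r (\<lambda>u v. if inv \<pi> u < inv \<pi> v then j (inv \<pi> u) * j (inv \<pi> v) else 0)"
proof -
  note p = permutes_inverses[OF assms] permutes_in_image[OF assms] permutes_in_image[OF permutes_inv[OF assms]]
  have lt: "\<pi> x < r \<longleftrightarrow> x < r" "inv \<pi> x < r \<longleftrightarrow> x < r" for x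
    using p(3)[of x] p(4)[of x] by auto
  have "tri r (\<lambda>p q. if \<pi> p < \<pi> q then j p * j q else 0) =
     (\<Sum>(p, q)\<in>{(p, q). q < p \<and> p < r \<and> \<pi> p < \<pi> q}. j p * j q)"
    unfolding tri_pairs
    by (rule sum.mono_neutral_cong_right) (auto simp: finite_tri_pairs split: if_splits)
  also have "\<dots> = (\<Sum>(u, v)\<in>{(u, v). v < u \<and> u < r \<and> inv \<pi> u < inv \<pi> v}. j (inv \<pi> u) * j (inv \<pi> v))"
    by (rule sum.reindex_bij_witness[where i = "\<lambda>(u, v). (inv \<pi> v, inv \<pi> u)" and j = "\<lambda>(p, q). (\<pi> q, \<pi> p)"])
       (auto simp: p lt)
  also have "\<dots> = tri r (\<lambda>u v. if inv \<pi> u < inv \<pi> v then j (inv \<pi> u) * j (inv \<pi> v) else 0)"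
    unfolding tri_pairs
    by (rule sum.mono_neutral_cong_left) (auto simp: finite_tri_pairs split: if_splits)
  finally show ?thesis .
qed

text \<open>The three exponents come from the supertrace, from expanding the operator of
  \<open>\<sigma>\<close> in matrix units, and from its action on tensors. Those of the graded
  product and of X_1 ... X_r cancel in \<open>diagonal_entry\<close>.\<close>

definition ordsgn :: "nat \<Rightarrow> (nat \<Rightarrow> nat) \<Rightarrow> (nat \<Rightarrow> nat) \<Rightarrow> nat" where
  "ordsgn r j \<sigma> = (\<Sum>p<r. j p) + tri r (\<lambda>p q. (j (inv \<sigma> p) + j p) * j q) +
    tri r (\<lambda>p q. if \<sigma> p < \<sigma> q then j p * j q else 0)"

text \<open>Bookkeeping for \<open>ordsgn_adjacent_swap\<close>, with \<open>D\<close> the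
  commutation exponent. The inversion sum changes in two stages, through the intermediate
  permutation \<open>t \<circ> \<sigma>\<close>; \<open>H = K'\<close> and \<open>G = K\<close> are
  the two passages to inverses.\<close>

lemma ordsgn_adjacent_swap_parity:
  fixes S :: nat
  assumes "S' = S" "F' + f1 = F + f2" "H' + h1 = H + h2" "K' + k1 = K + k2" "H = K'" "G = K"
    "h1 + h2 = A" "k1 + k2 = B" "E' = S' + F' + H'" "E = S + F + G" "even (f1 + f2 + A + B + D)"
  shows "even (E' + E + D)"
proof -
  \<comment> \<open>An even number is added so that no natural numbers have to be
    subtracted.\<close>
  have eq: "E' + E + D + 2 * (f1 + h1 + k1) = 2 * (S + F + K) + (f1 + f2 + A + B + D)"
    using assms(2-5) unfolding assms(1,6,9,10) assms(7,8)[symmetric] by presburger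
  have "even (E' + E + D + 2 * (f1 + h1 + k1))" unfolding eq using assms(11) by simp
  then show ?thesis by simp
qed

text \<open>The last summand is the product of the degrees of the generators at positions
  \<open>a\<close> and \<open>Suc a\<close> in \<open>perm_term\<close>, so the sign changes exactly
  as when these are exchanged.\<close>

lemma ordsgn_adjacent_swap:
  assumes \<sigma>: "\<sigma> permutes {..<r}" and a: "Suc a < r"
  defines "t \<equiv> transpose a (Suc a)"
  shows "even (ordsgn r (j \<circ> t) (t \<circ> \<sigma> \<circ> t) + ordsgn r j \<sigma> +
    (j (inv \<sigma> a) + j a) * (j (inv \<sigma> (Suc a)) + j (Suc a)))"
proof -
  have t: "t permutes {..<r}" "t a = Suc a" "t (Suc a) = a" "\<And>x. t (t x) = x" "inv t = t"
    using a by (auto simp: t_def intro!: permutes_swap_id)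
  have t\<sigma>: "t \<circ> \<sigma> permutes {..<r}" by (intro permutes_compose \<sigma> t)
  have inv_t\<sigma>: "inv (t \<circ> \<sigma>) = inv \<sigma> \<circ> t"
    by (rule inv_unique_comp) (simp_all add: fun_eq_iff t permutes_inverses[OF \<sigma>])
  have inv_c: "inv (t \<circ> \<sigma> \<circ> t) = t \<circ> inv \<sigma> \<circ> t"
    by (rule inv_unique_comp) (simp_all add: fun_eq_iff t permutes_inverses[OF \<sigma>])
  have ne: "t (\<sigma> a) \<noteq> t (\<sigma> (Suc a))" "inv \<sigma> a \<noteq> inv \<sigma> (Suc a)"
    using permutes_inj[OF t\<sigma>] permutes_inj[OF permutes_inv[OF \<sigma>]]
    by (metis comp_apply injD n_not_Suc_n, metis injD n_not_Suc_n)
  define f where "f p q = (j (inv \<sigma> p) + j p) * j q" for p q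
  define h where "h p q = (if t (\<sigma> p) < t (\<sigma> q) then j p * j q else 0)" for p q
  define k where "k u v = (if inv \<sigma> u < inv \<sigma> v then j (inv \<sigma> u) * j (inv \<sigma> v) else 0)" for u v
  have "(\<Sum>p<r. (j \<circ> t) p) = (\<Sum>p<r. j p)"
    using sum.permute[OF t(1), of j] by simp
  moreover have "tri r (\<lambda>p q. f (t p) (t q)) + f (Suc a) a = tri r f + f a (Suc a)"
    "tri r (\<lambda>p q. h (t p) (t q)) + h (Suc a) a = tri r h + h a (Suc a)"
    "tri r (\<lambda>p q. k (t p) (t q)) + k (Suc a) a = tri r k + k a (Suc a)"
    unfolding t_def by (rule tri_adjacent_swap[OF a])+
  moreover have "tri r h = tri r (\<lambda>p q. k (t p) (t q))"
    using tri_inversions[OF t\<sigma>, of j] by (simp add: h_def[abs_def] k_def[abs_def] inv_t\<sigma> cong: if_cong)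
  moreover have "tri r (\<lambda>p q. if \<sigma> p < \<sigma> q then j p * j q else 0) = tri r k"
    using tri_inversions[OF \<sigma>, of j] by (simp add: k_def[abs_def])
  moreover have "h (Suc a) a + h a (Suc a) = j a * j (Suc a)"
    "k (Suc a) a + k a (Suc a) = j (inv \<sigma> a) * j (inv \<sigma> (Suc a))"
    using ne by (auto simp: h_def k_def)
  moreover have "ordsgn r (j \<circ> t) (t \<circ> \<sigma> \<circ> t) = (\<Sum>p<r. (j \<circ> t) p) + tri r (\<lambda>p q. f (t p) (t q)) +
      tri r (\<lambda>p q. h (t p) (t q))"
    by (simp add: ordsgn_def inv_c f_def h_def t cong: if_cong)
  moreover have "ordsgn r j \<sigma> = (\<Sum>p<r. j p) + tri r f + tri r (\<lambda>p q. if \<sigma> p < \<sigma> q then j p * j q else 0)"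
    by (simp add: ordsgn_def f_def[abs_def])
  moreover have "even (f (Suc a) a + f a (Suc a) + j a * j (Suc a) + j (inv \<sigma> a) * j (inv \<sigma> (Suc a)) +
      (j (inv \<sigma> a) + j a) * (j (inv \<sigma> (Suc a)) + j (Suc a)))"
    by (simp add: f_def) blast
  ultimately show ?thesis by (rule ordsgn_adjacent_swap_parity)
qed

text \<open>This compares the exponent of a descending cycle with the exponent of a star power. The
  path is left open, with \<open>j (Suc k)\<close> arbitrary, so that induction can extend it; the
  terms in the last line after the path sum become even once \<open>j (Suc k) = j 0\<close>.\<close>

lemma block_sign:
  fixes j :: "nat \<Rightarrow> nat"
  shows "even ((\<Sum>p<Suc k. j p) + (\<Sum>p<Suc k. (j p + j (Suc p)) * (\<Sum>q<p. j q)) + j 0 * (\<Sum>q<k. j (Suc q)) +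
    (j 0 + (\<Sum>t<k. (j 0 + j (Suc t)) * (j (Suc t) + j (Suc (Suc t))))) +
    (j (Suc k) + j 0) * (\<Sum>p<Suc k. j p) + j 0 + j 0 * j (Suc k))"
proof (induction k)
  case 0
  show ?case by auto
next
  case (Suc k)
  define S where "S = (\<Sum>p<Suc k. j p)"
  have S': "(\<Sum>p<Suc (Suc k). j p) = S + j (Suc k)" by (simp add: S_def)
  define X where "X = (\<Sum>p<Suc k. (j p + j (Suc p)) * (\<Sum>q<p. j q))"
  have X': "(\<Sum>p<Suc (Suc k). (j p + j (Suc p)) * (\<Sum>q<p. j q)) = X + (j (Suc k) + j (Suc (Suc k))) * S"
    by (simp add: X_def S_def)
  define U where "U = (\<Sum>q<k. j (Suc q))"
  have U': "(\<Sum>q<Suc k. j (Suc q)) = U + j (Suc k)" by (simp add: U_def)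
  define V where "V = (\<Sum>t<k. (j 0 + j (Suc t)) * (j (Suc t) + j (Suc (Suc t))))"
  have V': "(\<Sum>t<Suc k. (j 0 + j (Suc t)) * (j (Suc t) + j (Suc (Suc t)))) =
    V + (j 0 + j (Suc k)) * (j (Suc k) + j (Suc (Suc k)))" by (simp add: V_def)
  have "even (S + X + j 0 * U + (j 0 + V) + (j (Suc k) + j 0) * S + j 0 + j 0 * j (Suc k))"
    using Suc.IH by (simp only: S_def X_def U_def V_def)
  then show ?case
    unfolding S' X' U' V' by (simp only: even_add even_mult_iff) blast
qed

section \<open>Supertraces of permutations\<close>

text \<open>The contribution of the column tuple \<open>J\<close> of \<open>\<sigma>\<close> to the supertrace of \<open>\<sigma> X\<^sub>1 \<cdots> X\<^sub>r\<close>;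
  \<^const>\<open>ordsgn\<close> collects all signs, including that of the supertrace.\<close>
definition perm_term :: "nat \<Rightarrow> nat list \<Rightarrow> (nat \<Rightarrow> nat) \<Rightarrow> salg" where
  "perm_term m J \<sigma> = asmul (sgnc (ordsgn (length J) (\<lambda>p. par m (J ! p)) \<sigma>))
    (aprod (map (\<lambda>p. xgen m (J ! p) (J ! inv \<sigma> p)) [0..<length J]))"

lemma permutes_less: "\<pi> permutes {..<r} \<Longrightarrow> \<pi> p < r \<longleftrightarrow> p < (r :: nat)"
  using permutes_in_image[of \<pi> "{..<r}" p] by simp

lemma tri_cong: "(\<And>p q. q < p \<Longrightarrow> p < r \<Longrightarrow> f p q = g p q) \<Longrightarrow> tri r f = tri r g"
  by (simp add: tri_def)

lemma ordsgn_cong: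
  assumes "\<And>p. p < r \<Longrightarrow> j p = j' p" "\<sigma> permutes {..<r}"
  shows "ordsgn r j \<sigma> = ordsgn r j' \<sigma>"
proof -
  note lt = permutes_less[OF permutes_inv[OF assms(2)]]
  have "tri r (\<lambda>p q. (j (inv \<sigma> p) + j p) * j q) = tri r (\<lambda>p q. (j' (inv \<sigma> p) + j' p) * j' q)"
    by (rule tri_cong) (simp add: assms(1) lt)
  moreover have "tri r (\<lambda>p q. if \<sigma> p < \<sigma> q then j p * j q else 0) =
      tri r (\<lambda>p q. if \<sigma> p < \<sigma> q then j' p * j' q else 0)"
    by (rule tri_cong) (simp add: assms(1))
  ultimately show ?thesis by (simp add: ordsgn_def assms(1))
qed

lemma aprod_adjacent_swap:
  assumes "Suc a < r"
  defines "t \<equiv> transpose a (Suc a)"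
  shows "aprod (map (\<lambda>p. xgen m (u (t p)) (v (t p))) [0..<r]) =
    asmul (sgnc ((par m (u a) + par m (v a)) * (par m (u (Suc a)) + par m (v (Suc a)))))
      (aprod (map (\<lambda>p. xgen m (u p) (v p)) [0..<r]))"
proof -
  have split: "[0..<r] = [0..<a] @ [a, Suc a] @ [Suc (Suc a)..<r]"
  proof -
    have "[0..<r] = [0..<a] @ [a..<r]" using assms(1) upt_add_eq_append[of 0 a "r - a"] by simp
    then show ?thesis using assms(1) by (simp add: upt_conv_Cons)
  qed
  have pair: "aprod [xgen m i j, xgen m k l] = amul (xgen m i j) (xgen m k l)" for i j k l
    using aprod_snoc[of "[xgen m i j]" "xgen m k l"] by (simp add: aprod_singleton)
  have "map (\<lambda>p. xgen m (u (t p)) (v (t p))) [0..<r] = map (\<lambda>p. xgen m (u p) (v p)) [0..<a] @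
      [xgen m (u (Suc a)) (v (Suc a)), xgen m (u a) (v a)] @ map (\<lambda>p. xgen m (u p) (v p)) [Suc (Suc a)..<r]"
    unfolding split by (auto simp: t_def transpose_def)
  moreover have "map (\<lambda>p. xgen m (u p) (v p)) [0..<r] = map (\<lambda>p. xgen m (u p) (v p)) [0..<a] @
      [xgen m (u a) (v a), xgen m (u (Suc a)) (v (Suc a))] @ map (\<lambda>p. xgen m (u p) (v p)) [Suc (Suc a)..<r]"
    unfolding split by simp
  ultimately show ?thesis
    by (simp only: aprod_append pair) (subst xgen_commute, simp add: mult.commute)
qed

lemma inv_conj_transpose:
  assumes "\<sigma> permutes S" shows "inv (transpose a b \<circ> \<sigma> \<circ> transpose a b) = transpose a b \<circ> inv \<sigma> \<circ> transpose a b"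
  by (rule inv_unique_comp) (simp_all add: fun_eq_iff permutes_inverses[OF assms])

text \<open>The relabelling only exchanges two neighbouring factors, and the sign from
  \<open>xgen_commute\<close> cancels the parity change of
  \<open>ordsgn_adjacent_swap\<close>.\<close>

lemma perm_term_adjacent:
  assumes \<sigma>: "\<sigma> permutes {..<length J}" and a: "Suc a < length J"
  defines "t \<equiv> transpose a (Suc a)"
  shows "perm_term m (permute_list t J) (t \<circ> \<sigma> \<circ> t) = perm_term m J \<sigma>"
proof -
  let ?r = "length J" and ?j = "\<lambda>p. par m (J ! p)"
  have t: "t permutes {..<?r}" using a by (auto simp: t_def intro!: permutes_swap_id)
  note lt = permutes_less[OF t] permutes_less[OF permutes_inv[OF \<sigma>]]
  have inv_c: "inv (t \<circ> \<sigma> \<circ> t) = t \<circ> inv \<sigma> \<circ> t" and tt: "t (t x) = x" for x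
    by (simp_all add: t_def inv_conj_transpose[OF \<sigma>])
  have "aprod (map (\<lambda>p. xgen m (permute_list t J ! p) (permute_list t J ! inv (t \<circ> \<sigma> \<circ> t) p)) [0..<?r]) =
      aprod (map (\<lambda>p. xgen m (J ! t p) (J ! inv \<sigma> (t p))) [0..<?r])"
    by (intro arg_cong[of _ _ aprod] map_cong refl)
       (simp_all add: permute_list_nth[OF t] inv_c lt tt)
  also have "\<dots> = asmul (sgnc ((?j a + ?j (inv \<sigma> a)) * (?j (Suc a) + ?j (inv \<sigma> (Suc a)))))
      (aprod (map (\<lambda>p. xgen m (J ! p) (J ! inv \<sigma> p)) [0..<?r]))"
    unfolding t_def by (rule aprod_adjacent_swap[OF a])
  finally have prod: "aprod (map (\<lambda>p. xgen m (permute_list t J ! p) (permute_list t J ! inv (t \<circ> \<sigma> \<circ> t) p)) [0..<?r]) = \<dots>" .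
  have "ordsgn ?r (\<lambda>p. par m (permute_list t J ! p)) (t \<circ> \<sigma> \<circ> t) = ordsgn ?r (?j \<circ> t) (t \<circ> \<sigma> \<circ> t)"
    by (rule ordsgn_cong) (simp_all add: permute_list_nth[OF t] permutes_compose t \<sigma>)
  moreover have "sgnc (ordsgn ?r (?j \<circ> t) (t \<circ> \<sigma> \<circ> t)) =
      sgnc (ordsgn ?r ?j \<sigma> + (?j a + ?j (inv \<sigma> a)) * (?j (Suc a) + ?j (inv \<sigma> (Suc a))))"
    using ordsgn_adjacent_swap[OF \<sigma> a, of ?j] unfolding t_def[symmetric]
    by (intro sgnc_eqI) (simp add: add_ac)
  ultimately show ?thesis
    by (simp add: perm_term_def prod sgnc_add mult.assoc)
qed

lemma perm_term_transpose:
  assumes "\<sigma> permutes {..<length J}" "a < length J" "b < length J"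
  shows "perm_term m (permute_list (transpose a b) J) (transpose a b \<circ> \<sigma> \<circ> transpose a b) = perm_term m J \<sigma>"
proof -
  \<comment> \<open>\<open>J\<close> and \<open>\<sigma>\<close> are generalised because the
    induction applies the claim to a relabelled pair.\<close>
  have less: "perm_term m (permute_list (transpose a b) J) (transpose a b \<circ> \<sigma> \<circ> transpose a b) = perm_term m J \<sigma>"
    if "a < b" "b < length J" "\<sigma> permutes {..<length J}" for a b J \<sigma>
    using that
  proof (induction b arbitrary: J \<sigma>)
    case (Suc b)
    show ?case
    proof (cases "a = b")
      case True
      show ?thesis unfolding True using Suc.prems by (intro perm_term_adjacent) auto
    next
      case False
      let ?s = "transpose b (Suc b)" and ?u = "transpose a b"
      let ?J = "permute_list ?s J"
      have s: "?s permutes {..<length J}" and u: "?u permutes {..<length J}"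
        using Suc.prems by (auto intro!: permutes_swap_id)
      \<comment> \<open>A longer transposition is a shorter one conjugated by an adjacent
        one.\<close>
      have eq: "transpose a (Suc b) = ?s \<circ> ?u \<circ> ?s"
        using False Suc.prems by (auto simp: transpose_def fun_eq_iff)
      have 1: "permute_list (transpose a (Suc b)) J = permute_list ?s (permute_list ?u ?J)"
        unfolding eq using s u by (simp add: permute_list_compose permutes_compose o_assoc[symmetric])
      have c: "?s \<circ> \<sigma> \<circ> ?s permutes {..<length J}"
        by (intro permutes_compose s Suc.prems)
      have d: "?u \<circ> (?s \<circ> \<sigma> \<circ> ?s) \<circ> ?u permutes {..<length J}"
        by (intro permutes_compose u c)
      have "perm_term m ?J (?s \<circ> \<sigma> \<circ> ?s) = perm_term m J \<sigma>"
        using Suc.prems by (intro perm_term_adjacent) auto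
      moreover have "perm_term m (permute_list ?u ?J) (?u \<circ> (?s \<circ> \<sigma> \<circ> ?s) \<circ> ?u) = perm_term m ?J (?s \<circ> \<sigma> \<circ> ?s)"
        by (rule Suc.IH) (use False Suc.prems in simp, use Suc.prems in simp, use c in \<open>simp only: length_permute_list\<close>)
      moreover have "perm_term m (permute_list ?s (permute_list ?u ?J)) (?s \<circ> (?u \<circ> (?s \<circ> \<sigma> \<circ> ?s) \<circ> ?u) \<circ> ?s) =
          perm_term m (permute_list ?u ?J) (?u \<circ> (?s \<circ> \<sigma> \<circ> ?s) \<circ> ?u)"
        by (rule perm_term_adjacent) (use d in \<open>simp only: length_permute_list\<close>, use Suc.prems in simp)
      ultimately show ?thesis unfolding 1 unfolding eq by (simp add: o_def)
    qed
  qed simp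
  consider "a < b" | "b < a" | "a = b" by linarith
  then show ?thesis
  proof cases
    case 2
    then show ?thesis using less[of b a J \<sigma>] assms by (simp add: transpose_commute)
  next
    case 3
    then show ?thesis by (simp add: transpose_same)
  qed (use less assms in auto)
qed

text \<open>In this form, monomial by monomial, the commutation of X_1 ... X_r with the symmetric
  group enters the proof.\<close>

lemma perm_term_conj:
  assumes "\<tau> permutes {..<length J}" "\<sigma> permutes {..<length J}"
  shows "perm_term m (permute_list \<tau> J) (inv \<tau> \<circ> \<sigma> \<circ> \<tau>) = perm_term m J \<sigma>"
proof -
  have "\<forall>J \<sigma>. length J = r \<longrightarrow> \<sigma> permutes {..<r} \<longrightarrow>
      perm_term m (permute_list \<tau> J) (inv \<tau> \<circ> \<sigma> \<circ> \<tau>) = perm_term m J \<sigma>"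
    if "\<tau> permutes {..<r}" for r
    using that finite_lessThan
  proof (induction rule: permutes_induct)
    case (swap a b p)
    show ?case
    proof (intro allI impI)
      fix J :: "nat list" and \<sigma> assume J: "length J = r" and \<sigma>: "\<sigma> permutes {..<r}"
      let ?t = "transpose a b"
      have t: "?t permutes {..<r}" using swap by (auto intro!: permutes_swap_id)
      have "inv (?t \<circ> p) = inv p \<circ> ?t"
        by (rule inv_unique_comp) (simp_all add: fun_eq_iff permutes_inverses[OF swap.hyps(4)])
      then have "perm_term m (permute_list (?t \<circ> p) J) (inv (?t \<circ> p) \<circ> \<sigma> \<circ> (?t \<circ> p)) =
          perm_term m (permute_list p (permute_list ?t J)) (inv p \<circ> (?t \<circ> \<sigma> \<circ> ?t) \<circ> p)"
        using swap.hyps J by (simp add: permute_list_compose o_assoc)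
      also have "\<dots> = perm_term m (permute_list ?t J) (?t \<circ> \<sigma> \<circ> ?t)"
        by (rule swap.IH[rule_format]) (use J in simp, intro permutes_compose t \<sigma>)
      also have "\<dots> = perm_term m J \<sigma>"
        using swap.hyps J \<sigma> by (intro perm_term_transpose) auto
      finally show "perm_term m (permute_list (?t \<circ> p) J) (inv (?t \<circ> p) \<circ> \<sigma> \<circ> (?t \<circ> p)) = perm_term m J \<sigma>" .
    qed
  qed simp
  with assms show ?thesis by blast
qed

subsection \<open>Super-immanants as signed sums\<close>

lemma finite_idx [simp]: "finite (idx N k)"
  using finite_lists_length_eq[of "{1..N}" k] by (simp add: idx_def conj_commute)

lemma idx_length: "I \<in> idx N k \<Longrightarrow> length I = k"
  by (simp add: idx_def)

lemma permute_list_idx: "\<pi> permutes {..<k} \<Longrightarrow> I \<in> idx N k \<Longrightarrow> permute_list \<pi> I \<in> idx N k"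
  by (auto simp: idx_def)

text \<open>After \<open>a\<close> factors the positions from \<open>a\<close> on still carry the
  identity, which forces \<open>I\<close> and \<open>L\<close> to agree there.\<close>

lemma Xprod_partial:
  assumes "I \<in> idx (m + n) k" "L \<in> idx (m + n) k" "a \<le> k"
  shows "foldl (\<lambda>T a. tmul m n k T (Xa m k a)) tone [0..<a] I L =
    (if \<forall>b<k. a \<le> b \<longrightarrow> I ! b = L ! b
     then asmul (sgnc (tri a (\<lambda>p q. (par m (I ! p) + par m (L ! p)) * (par m (I ! q) + par m (L ! q)))))
       (aprod (map (\<lambda>p. xgen m (I ! p) (L ! p)) [0..<a])) else 0)"
  using assms
proof (induction a arbitrary: L)
  case 0
  have "I = L \<longleftrightarrow> (\<forall>b<k. I ! b = L ! b)"
    using 0 by (auto simp: idx_def intro: nth_equalityI)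
  then show ?case by (cases "I = L") (auto simp: tone_def tri_def)
next
  case (Suc a)
  let ?T = "foldl (\<lambda>T a. tmul m n k T (Xa m k a)) tone [0..<a]"
  let ?d = "\<lambda>p. par m (I ! p) + par m (L ! p)"
  define C where "C \<longleftrightarrow> (\<forall>b<k. Suc a \<le> b \<longrightarrow> I ! b = L ! b)"
  \<comment> \<open>The only intermediate tuple with a nonzero term: processed positions have
    reached \<open>L\<close>, the others are still at \<open>I\<close>.\<close>
  define J0 where "J0 = take a L @ drop a I"
  define f where "f J = asmul (sgnc (\<Sum>p<k. \<Sum>q<p. (par m (I ! p) + par m (J ! p)) * (par m (J ! q) + par m (L ! q))))
        (amul (?T I J) (pinv (edeg m I J) (Xa m k a J L)))" for J
  have len: "length I = k" "length L = k" "a < k" using Suc.prems by (auto simp: idx_def)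
  have J0: "J0 \<in> idx (m + n) k"
    using Suc.prems by (auto simp: idx_def J0_def dest: in_set_takeD in_set_dropD)
  have J0_nth: "J0 ! p = (if p < a then L ! p else I ! p)" if "p < k" for p
    using that len by (simp add: J0_def nth_append)
  have zero: "f J = 0" if J: "J \<in> idx (m + n) k" "J \<noteq> J0 \<or> \<not> C" for J
  proof (rule ccontr)
    assume "f J \<noteq> 0"
    then have "?T I J \<noteq> 0" "Xa m k a J L \<noteq> 0"
      by (auto simp: f_def pinv_simps)
    then have *: "\<forall>b<k. a \<le> b \<longrightarrow> I ! b = J ! b" "\<forall>b<k. b \<noteq> a \<longrightarrow> J ! b = L ! b"
      using Suc.IH[OF Suc.prems(1) J(1)] len by (auto simp: Xa_def split: if_splits)
    have "J = J0"
    proof (rule nth_equalityI)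
      fix p assume "p < length J"
      then have "p < k" using J by (simp add: idx_def)
      then show "J ! p = J0 ! p" using * by (cases "p < a") (auto simp: J0_nth)
    qed (use J J0 in \<open>auto simp: idx_def\<close>)
    moreover have "C" using * unfolding C_def by (metis Suc_leD Suc_n_not_le_n)
    ultimately show False using J by simp
  qed
  have val: "f J0 = asmul (sgnc (tri (Suc a) (\<lambda>p q. ?d p * ?d q)))
       (aprod (map (\<lambda>p. xgen m (I ! p) (L ! p)) [0..<Suc a]))" if C
  proof -
    \<comment> \<open>For \<open>p < a\<close> the second factor is even because \<open>J0\<close>
      agrees with \<open>L\<close> at \<open>q\<close>; otherwise the first is even because
      \<open>J0\<close> agrees with \<open>I\<close> at \<open>p\<close>.\<close>
    have "even (\<Sum>p<k. \<Sum>q<p. (par m (I ! p) + par m (J0 ! p)) * (par m (J0 ! q) + par m (L ! q)))"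
    proof (intro dvd_sum)
      fix p q assume "p \<in> {..<k}" "q \<in> {..<p}"
      then show "even ((par m (I ! p) + par m (J0 ! p)) * (par m (J0 ! q) + par m (L ! q)))"
        by (cases "p < a") (auto simp: J0_nth)
    qed
    moreover have "?T I J0 = asmul (sgnc (tri a (\<lambda>p q. ?d p * ?d q))) (aprod (map (\<lambda>p. xgen m (I ! p) (L ! p)) [0..<a]))"
      using Suc.IH[OF Suc.prems(1) J0] len by (auto simp: J0_nth intro!: arg_cong2[of _ _ _ _ asmul]
          arg_cong[of _ _ sgnc] tri_cong arg_cong[of _ _ aprod])
    moreover have "Xa m k a J0 L = xgen m (I ! a) (L ! a)"
      using len \<open>C\<close> by (auto simp: Xa_def J0_nth C_def)
    \<comment> \<open>The sign of moving the new generator past the matrix units; unprocessed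
      positions contribute even degree.\<close>
    moreover have "sgnc (edeg m I J0 * ?d a) = sgnc (\<Sum>q<a. ?d a * ?d q)"
    proof (rule sgnc_eqI)
      have "edeg m I J0 = (\<Sum>p<a. ?d p) + (\<Sum>p\<in>{a..<k}. 2 * par m (I ! p))"
      proof -
        let ?g = "\<lambda>p. par m (I ! p) + par m (J0 ! p)"
        have "edeg m I J0 = (\<Sum>p<a. ?g p) + (\<Sum>p\<in>{a..<k}. ?g p)"
          unfolding edeg_def len(1) lessThan_atLeast0 using len(3) by (simp add: sum.atLeastLessThan_concat)
        moreover have "(\<Sum>p<a. ?g p) = (\<Sum>p<a. ?d p)"
          using len(3) by (intro sum.cong) (simp_all add: J0_nth)
        moreover have "(\<Sum>p\<in>{a..<k}. ?g p) = (\<Sum>p\<in>{a..<k}. 2 * par m (I ! p))"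
          by (intro sum.cong) (simp_all add: J0_nth)
        ultimately show ?thesis by simp
      qed
      moreover have "even (\<Sum>p\<in>{a..<k}. 2 * par m (I ! p))" by (simp add: sum_distrib_left[symmetric])
      moreover have "(\<Sum>q<a. ?d a * ?d q) = ?d a * (\<Sum>q<a. ?d q)"
        by (simp only: sum_distrib_left)
      moreover have "even ((u + v) * w + w * u)" if "even v" for u v w :: nat
        using that by auto
      ultimately show "even (edeg m I J0 * ?d a + (\<Sum>q<a. ?d a * ?d q))"
        by metis
    qed
    ultimately show ?thesis
      by (simp add: f_def sgnc_even pinv_simps aprod_snoc tri_def sgnc_add mult_ac)
  qed
  have "foldl (\<lambda>T a. tmul m n k T (Xa m k a)) tone [0..<Suc a] I L = (\<Sum>J\<in>idx (m + n) k. f J)"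
    by (simp add: tmul_def f_def)
  also have "\<dots> = (if C then f J0 else 0)"
    using zero J0 by (auto simp: sum.remove[OF finite_idx J0] intro!: sum.neutral)
  also have "\<dots> = (if C then asmul (sgnc (tri (Suc a) (\<lambda>p q. ?d p * ?d q)))
       (aprod (map (\<lambda>p. xgen m (I ! p) (L ! p)) [0..<Suc a])) else 0)"
    using val by simp
  finally show ?case unfolding C_def .
qed

lemma Xprod_apply:
  assumes "I \<in> idx (m + n) k" "L \<in> idx (m + n) k"
  shows "Xprod m n k I L =
    asmul (sgnc (tri k (\<lambda>p q. (par m (I ! p) + par m (L ! p)) * (par m (I ! q) + par m (L ! q)))))
      (aprod (map (\<lambda>p. xgen m (I ! p) (L ! p)) [0..<k]))"
  using Xprod_partial[OF assms order.refl] by (simp add: Xprod_def)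

lemma inv_into_permutes:
  assumes "\<sigma> permutes {..<k}" "p < (k :: nat)"
  shows "inv_into {0..<k} \<sigma> p = inv \<sigma> p"
proof (rule inv_into_f_eq)
  show "inj_on \<sigma> {0..<k}" using permutes_inj[OF assms(1)] by (rule inj_on_subset) simp
  show "inv \<sigma> p \<in> {0..<k}" using permutes_less[OF permutes_inv[OF assms(1)], of p] assms by simp
qed (simp add: permutes_inverses[OF assms(1)])

lemma permsgn_eq_tri:
  "permsgn m k \<sigma> J = tri k (\<lambda>p q. if \<sigma> p < \<sigma> q then par m (J ! p) * par m (J ! q) else 0)"
proof -
  have "permsgn m k \<sigma> J =
      (\<Sum>q<k. \<Sum>p<k. if p < q \<and> \<sigma> q < \<sigma> p then par m (J ! p) * par m (J ! q) else 0)"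
    unfolding permsgn_def by (rule sum.swap)
  also have "\<dots> = tri k (\<lambda>p q. if \<sigma> p < \<sigma> q then par m (J ! p) * par m (J ! q) else 0)"
    unfolding tri_def by (intro sum.cong refl sum.mono_neutral_cong_right) auto
  finally show ?thesis .
qed

text \<open>The graded product fixes the row tuple and sums over columns, so the condition in
  \<open>permT\<close> is solved for \<open>J\<close>.\<close>

lemma permT_eq:
  assumes \<sigma>: "\<sigma> permutes {..<k}" and len: "length I = k" "length J = k"
  shows "permT m k \<sigma> I J = (if J = permute_list \<sigma> I
     then ascal (sgnc (tri k (\<lambda>p q. (par m (I ! p) + par m (J ! p)) * par m (J ! q)) +
       tri k (\<lambda>p q. if \<sigma> p < \<sigma> q then par m (J ! p) * par m (J ! q) else 0))) else 0)"
proof -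
  have "map (\<lambda>p. J ! inv_into {0..<k} \<sigma> p) [0..<k] = permute_list (inv \<sigma>) J"
    using inv_into_permutes[OF \<sigma>] len by (simp add: permute_list_def)
  moreover have "I = permute_list (inv \<sigma>) J \<longleftrightarrow> J = permute_list \<sigma> I"
    using permute_list_compose[of \<sigma> J "inv \<sigma>"] permute_list_compose[of "inv \<sigma>" I \<sigma>] \<sigma> permutes_inv[OF \<sigma>] len
    by (metis permutes_inv_o permute_list_id)
  ultimately show ?thesis
    by (simp add: permT_def permsgn_eq_tri[symmetric] tri_def)
qed

lemma amul_ascal: "fin_odd f \<Longrightarrow> amul (ascal c) f = asmul c f"
  by (subst ascal_eq_asmul) (simp add: amul_ascal_left)

lemma fin_odd_asmul [simp]: "fin_odd f \<Longrightarrow> fin_odd (asmul c f)"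
  by (simp add: fin_odd_def asmul_def)

lemma fin_odd_sum [simp]: "(\<And>a. a \<in> A \<Longrightarrow> fin_odd (f a)) \<Longrightarrow> fin_odd (\<Sum>a\<in>A. f a)"
  by (simp add: fin_odd_def sum_salg_apply)

lemma fin_odd_perm_term [simp]: "fin_odd (perm_term m J \<sigma>)"
  by (simp add: perm_term_def)

text \<open>Only the column tuple \<open>permute_list \<sigma> I\<close> survives. The exponent of
  the graded product equals that of \<open>Xprod m n k J I\<close>, so these two signs cancel, and
  \<open>pinv\<close> is trivial because \<open>J\<close> rearranges \<open>I\<close>.\<close>

lemma diagonal_entry:
  assumes \<sigma>: "\<sigma> permutes {..<k}" and I: "I \<in> idx (m + n) k"
  shows "(\<Sum>J\<in>idx (m + n) k.
      asmul (sgnc (\<Sum>p<k. \<Sum>q<p. (par m (I ! p) + par m (J ! p)) * (par m (J ! q) + par m (I ! q))))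
        (amul (permT m k \<sigma> I J) (pinv (edeg m I J) (Xprod m n k J I)))) =
    asmul (sgnc (\<Sum>p<k. par m (I ! p))) (perm_term m I \<sigma>)"
proof -
  define J where "J = permute_list \<sigma> I"
  let ?i = "\<lambda>p. par m (I ! p)" and ?j = "\<lambda>p. par m (J ! p)"
  have len: "length I = k" "length J = k" using I by (auto simp: idx_def J_def)
  have J: "J \<in> idx (m + n) k" using permute_list_idx[OF \<sigma> I] by (simp add: J_def)
  have nth: "J ! p = I ! \<sigma> p" if "p < k" for p
    using that len by (simp add: J_def permute_list_def)
  have nth_inv: "I ! p = J ! inv \<sigma> p" if "p < k" for p
    using nth[of "inv \<sigma> p"] permutes_less[OF permutes_inv[OF \<sigma>], of p] that by (simp add: permutes_inverses[OF \<sigma>])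
  have sum_eq: "(\<Sum>p<k. ?j p) = (\<Sum>p<k. ?i p)"
    using sum.permute[OF \<sigma>, of ?i] by (simp add: nth)
  let ?A = "tri k (\<lambda>p q. (?i p + ?j p) * (?j q + ?i q))"
  let ?B = "tri k (\<lambda>p q. (?i p + ?j p) * ?j q)"
  let ?C = "tri k (\<lambda>p q. if \<sigma> p < \<sigma> q then ?j p * ?j q else 0)"
  have edeg: "even (edeg m I J)"
    by (simp add: edeg_def len sum.distrib sum_eq)
  have X: "Xprod m n k J I = asmul (sgnc ?A) (aprod (map (\<lambda>p. xgen m (J ! p) (J ! inv \<sigma> p)) [0..<k]))"
    unfolding Xprod_apply[OF J I]
    by (intro arg_cong2[of _ _ _ _ asmul] arg_cong[of _ _ sgnc] arg_cong[of _ _ aprod] map_cong refl tri_cong)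
       (simp_all add: nth_inv[symmetric] add.commute)
  have "ordsgn k ?j \<sigma> = (\<Sum>p<k. ?i p) + ?B + ?C"
    unfolding ordsgn_def sum_eq by (intro arg_cong2[of _ _ _ _ "(+)"] refl tri_cong) (simp add: nth_inv)
  then have J_term: "perm_term m J \<sigma> = asmul (sgnc (\<Sum>p<k. ?i p) * sgnc (?B + ?C))
      (aprod (map (\<lambda>p. xgen m (J ! p) (J ! inv \<sigma> p)) [0..<k]))"
    by (simp add: perm_term_def len sgnc_add mult.assoc)
  have "(\<Sum>J\<in>idx (m + n) k.
      asmul (sgnc (\<Sum>p<k. \<Sum>q<p. (par m (I ! p) + par m (J ! p)) * (par m (J ! q) + par m (I ! q))))
        (amul (permT m k \<sigma> I J) (pinv (edeg m I J) (Xprod m n k J I)))) =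
      asmul (sgnc ?A) (amul (ascal (sgnc (?B + ?C))) (pinv (edeg m I J) (Xprod m n k J I)))"
    by (subst sum.remove[OF finite_idx J], subst sum.neutral)
       (auto simp: permT_eq[OF \<sigma>] len J_def[symmetric] tri_def idx_length)
  also have "\<dots> = asmul (sgnc (\<Sum>p<k. ?i p)) (perm_term m J \<sigma>)"
    by (simp add: edeg pinv_simps X J_term amul_ascal mult_ac)
  \<comment> \<open>Conjugation by \<open>\<sigma>\<close> itself fixes \<open>\<sigma>\<close> and
    trades the column tuple for the row tuple.\<close>
  also have "perm_term m J \<sigma> = perm_term m I \<sigma>"
    using perm_term_conj[of \<sigma> I \<sigma> m] \<sigma> len permutes_inv_o(2)[OF \<sigma>] by (simp add: J_def)
  finally show ?thesis .
qed

lemma super_imm_eq: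
  assumes I: "I \<in> idx (m + n) k"
  shows "super_imm m n lam I =
    (\<Sum>\<sigma> | \<sigma> permutes {..<k}. asmul (of_int (irr_char k lam \<sigma>)) (perm_term m I \<sigma>))"
proof -
  let ?S = "{\<sigma>. \<sigma> permutes {..<k}}"
  let ?\<chi> = "\<lambda>\<sigma>. of_int (irr_char k lam \<sigma>) :: complex"
  let ?s = "\<lambda>J. sgnc (\<Sum>p<k. \<Sum>q<p. (par m (I ! p) + par m (J ! p)) * (par m (J ! q) + par m (I ! q)))"
  let ?X = "\<lambda>J. pinv (edeg m I J) (Xprod m n k J I)"
  have len: "length I = k" using I by (rule idx_length)
  \<comment> \<open>On the diagonal the summands have the forms i(i+1) and j(i+i). The remaining
    sign in \<open>super_imm\<close> cancels the one left by \<open>diagonal_entry\<close>.\<close>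
  have gam: "even (gam m I I)"
    by (auto simp: gam_def intro!: dvd_sum)
  have "tmul m n k (chiT m k lam) (Xprod m n k) I I =
      (\<Sum>J\<in>idx (m + n) k. \<Sum>\<sigma>\<in>?S. asmul (?\<chi> \<sigma>) (asmul (?s J) (amul (permT m k \<sigma> I J) (?X J))))"
    unfolding tmul_def chiT_def atLeast0LessThan
    by (simp add: amul_sum_left asmul_sum mult.commute)
  also have "\<dots> = (\<Sum>\<sigma>\<in>?S. asmul (?\<chi> \<sigma>) (\<Sum>J\<in>idx (m + n) k. asmul (?s J) (amul (permT m k \<sigma> I J) (?X J))))"
    unfolding asmul_sum by (rule sum.swap)
  also have "\<dots> = (\<Sum>\<sigma>\<in>?S. asmul (?\<chi> \<sigma>) (asmul (sgnc (\<Sum>p<k. par m (I ! p))) (perm_term m I \<sigma>)))"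
    using diagonal_entry[OF _ I] by (intro sum.cong) simp_all
  finally have *: "tmul m n k (chiT m k lam) (Xprod m n k) I I = \<dots>" .
  show ?thesis
    unfolding super_imm_def Let_def len *
    by (simp add: asmul_sum sgnc_add sgnc_even[OF gam] mult_ac)
qed

section \<open>Summation over sorted index tuples\<close>

lemma sum_salg_const: "(\<Sum>a\<in>A. (c :: salg)) = asmul (of_nat (card A)) c"
  by (auto simp: fun_eq_iff sum_salg_apply asmul_apply)

text \<open>The fibre of \<open>sort\<close> over \<open>S\<close> consists of the arrangements of
  its multiset, r!/\<open>alpha S\<close> in number, and \<open>f\<close> is constant on it.\<close>

lemma sum_sorted_lists:
  fixes f :: "nat list \<Rightarrow> salg"
  assumes sym: "\<And>\<tau> I. \<tau> permutes {..<r} \<Longrightarrow> I \<in> idx N r \<Longrightarrow> f (permute_list \<tau> I) = f I"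
  shows "(\<Sum>I | I \<in> idx N r \<and> sorted I. asmul (1 / of_nat (alpha I)) (f I)) =
    asmul (1 / of_nat (fact r)) (\<Sum>I\<in>idx N r. f I)"
proof -
  let ?T = "{I \<in> idx N r. sorted I}"
  have "(\<Sum>I\<in>idx N r. f I) = (\<Sum>S\<in>?T. \<Sum>I\<in>{I \<in> idx N r. sort I = S}. f I)"
    by (rule sum.group[symmetric]) (simp_all, auto simp: idx_def)
  also have "\<dots> = (\<Sum>S\<in>?T. asmul (of_nat (fact r) / of_nat (alpha S)) (f S))"
  proof (intro sum.cong refl)
    fix S assume S: "S \<in> ?T"
    have perms: "{I \<in> idx N r. sort I = S} = permutations_of_multiset (mset S)"
    proof -
      have "I \<in> idx N r" if "mset I = mset S" for I
        using S mset_eq_setD[OF that] mset_eq_length[OF that] by (simp add: idx_def)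
      moreover have "sort I = S \<longleftrightarrow> mset I = mset S" for I
        using S properties_for_sort[of S I] by auto
      ultimately show ?thesis by (auto simp: permutations_of_multiset_def)
    qed
    have "f I = f S" if I: "I \<in> permutations_of_multiset (mset S)" for I
    proof -
      obtain p where "p permutes {..<length S}" "permute_list p S = I"
        by (rule mset_eq_permutation[OF permutations_of_multisetD[OF I]])
      then show ?thesis using sym[of p S] S by (simp add: idx_def)
    qed
    then have "(\<Sum>I\<in>{I \<in> idx N r. sort I = S}. f I) =
        asmul (of_nat (card (permutations_of_multiset (mset S)))) (f S)"
      unfolding perms by (simp add: sum_salg_const del: sum_constant)
    moreover have alpha_pos: "alpha S \<noteq> 0" by (simp add: alpha_def)
    moreover have "card (permutations_of_multiset (mset S)) * alpha S = fact r"
      using card_permutations_of_multiset_aux[of "mset S"] S by (simp add: alpha_def idx_def)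
    then have "(of_nat (card (permutations_of_multiset (mset S))) :: complex) = of_nat (fact r) / of_nat (alpha S)"
      using nonzero_eq_divide_eq[of "of_nat (alpha S) :: complex"] by (metis alpha_pos of_nat_eq_0_iff of_nat_mult)
    ultimately show "(\<Sum>I\<in>{I \<in> idx N r. sort I = S}. f I) = asmul (of_nat (fact r) / of_nat (alpha S)) (f S)"
      by simp
  qed
  finally show ?thesis by (simp add: asmul_sum)
qed

section \<open>Class functions and the symmetry of the immanant\<close>

lemma young_char_conj:
  assumes "a < r" "b < r"
  shows "young_char r mu (transpose a b \<circ> \<sigma> \<circ> transpose a b) = young_char r mu \<sigma>"
proof -
  define t where "t = transpose a b"
  have t: "t permutes {0..<r}" "t (t x) = x" "t x < r \<longleftrightarrow> x < r" for x
    using assms by (auto simp: t_def transpose_def intro!: permutes_swap_id)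
  define A where "A \<sigma> = {f \<in> {0..<r} \<rightarrow>\<^sub>E {0..<length mu}.
        (\<forall>a<length mu. card {p\<in>{0..<r}. f p = a} = nat (mu ! a)) \<and> (\<forall>p<r. f (\<sigma> p) = f p)}" for \<sigma>
  have *: "f \<circ> t \<in> A (t \<circ> \<sigma> \<circ> t)" if "f \<in> A \<sigma>" for f \<sigma>
  proof -
    have "card {p \<in> {0..<r}. f (t p) = a} = card {p \<in> {0..<r}. f p = a}" for a
      by (rule bij_betw_same_card[of t], rule bij_betw_byWitness[where f' = t]) (auto simp: t)
    moreover have "t x = x" if "\<not> x < r" for x using permutes_not_in[OF t(1)] that by simp
    ultimately show ?thesis
      using that t by (auto simp: A_def PiE_def extensional_def Pi_def)
  qed
  have tt: "t \<circ> (t \<circ> \<sigma> \<circ> t) \<circ> t = \<sigma>" "f \<circ> t \<circ> t = f" for f :: "nat \<Rightarrow> nat"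
    by (simp_all add: fun_eq_iff t)
  have "bij_betw (\<lambda>f. f \<circ> t) (A \<sigma>) (A (t \<circ> \<sigma> \<circ> t))"
    by (rule bij_betw_byWitness[where f' = "\<lambda>f. f \<circ> t"])
       (use * *[of _ "t \<circ> \<sigma> \<circ> t"] in \<open>auto simp: tt\<close>)
  from bij_betw_same_card[OF this] show ?thesis
    unfolding young_char_def t_def[symmetric] A_def by simp
qed

text \<open>A permutation and its inverse fix the same tabloids.\<close>

lemma young_char_inv:
  assumes "\<sigma> permutes {..<r}"
  shows "young_char r mu (inv \<sigma>) = young_char r mu \<sigma>"
proof -
  have "(\<forall>p<r. f (inv \<sigma> p) = f p) \<longleftrightarrow> (\<forall>p<r. f (\<sigma> p) = f p)" for f :: "nat \<Rightarrow> nat"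
    using permutes_less[OF assms] permutes_less[OF permutes_inv[OF assms]] permutes_inverses[OF assms] by metis
  then show ?thesis by (simp add: young_char_def)
qed

lemma irr_char_conj:
  assumes "a < r" "b < r"
  shows "irr_char r lam (transpose a b \<circ> \<sigma> \<circ> transpose a b) = irr_char r lam \<sigma>"
  by (simp only: irr_char_def young_char_conj[OF assms])

lemma irr_char_inv: "\<sigma> permutes {..<r} \<Longrightarrow> irr_char r lam (inv \<sigma>) = irr_char r lam \<sigma>"
  by (simp only: irr_char_def young_char_inv)

text \<open>The supertrace of \<open>\<sigma>\<close> X_1 ... X_r, expanded over column
  tuples.\<close>

definition cycle_sum :: "nat \<Rightarrow> nat \<Rightarrow> nat \<Rightarrow> (nat \<Rightarrow> nat) \<Rightarrow> salg" where
  "cycle_sum m n r \<sigma> = (\<Sum>J\<in>idx (m + n) r. perm_term m J \<sigma>)"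

lemma permute_list_transpose_twice:
  assumes "a < length J" "b < length J"
  shows "permute_list (transpose a b) (permute_list (transpose a b) J) = J"
  using permute_list_compose[of "transpose a b" J "transpose a b"] assms
  by (simp add: permutes_swap_id)

lemma cycle_sum_conj:
  assumes "\<sigma> permutes {..<r}" "a < r" "b < r"
  shows "cycle_sum m n r (transpose a b \<circ> \<sigma> \<circ> transpose a b) = cycle_sum m n r \<sigma>"
proof -
  let ?t = "transpose a b"
  have t: "?t permutes {..<r}" using assms by (intro permutes_swap_id) auto
  have tt: "permute_list ?t (permute_list ?t J) = J" if "J \<in> idx (m + n) r" for J
    using that assms by (intro permute_list_transpose_twice) (simp_all add: idx_length)
  have "(\<Sum>J\<in>idx (m + n) r. perm_term m J (?t \<circ> \<sigma> \<circ> ?t)) = (\<Sum>J\<in>idx (m + n) r. perm_term m J \<sigma>)"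
  proof (rule sum.reindex_bij_witness[where i = "permute_list ?t" and j = "permute_list ?t"])
    fix J assume J: "J \<in> idx (m + n) r"
    have "perm_term m (permute_list ?t (permute_list ?t J)) (?t \<circ> \<sigma> \<circ> ?t) = perm_term m (permute_list ?t J) \<sigma>"
      using assms J by (intro perm_term_transpose) (simp_all add: idx_length)
    then show "perm_term m (permute_list ?t J) \<sigma> = perm_term m J (?t \<circ> \<sigma> \<circ> ?t)"
      using tt[OF J] by metis
  qed (simp_all add: tt permute_list_idx[OF t])
  then show ?thesis by (simp only: cycle_sum_def)
qed

text \<open>A transposition of \<open>I\<close> is moved onto \<open>\<sigma>\<close> as a
  conjugation, where the character absorbs it.\<close>

lemma super_imm_symmetric:
  assumes \<tau>: "\<tau> permutes {..<r}" and I: "I \<in> idx (m + n) r"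
  shows "super_imm m n lam (permute_list \<tau> I) = super_imm m n lam I"
  using \<tau> finite_lessThan I
proof (induction arbitrary: I rule: permutes_induct)
  case (swap a b p)
  let ?t = "transpose a b"
  have t: "?t permutes {..<r}" using swap.hyps by (intro permutes_swap_id) auto
  have len: "length I = r" using swap.prems by (rule idx_length)
  have tI: "permute_list ?t I \<in> idx (m + n) r" by (rule permute_list_idx[OF t swap.prems])
  have "super_imm m n lam (permute_list (?t \<circ> p) I) = super_imm m n lam (permute_list p (permute_list ?t I))"
    using swap.hyps len by (simp add: permute_list_compose)
  also have "\<dots> = super_imm m n lam (permute_list ?t I)" by (rule swap.IH[OF tI])
  also have "\<dots> = (\<Sum>\<sigma> | \<sigma> permutes {..<r}. asmul (of_int (irr_char r lam \<sigma>)) (perm_term m I \<sigma>))"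
    unfolding super_imm_eq[OF tI]
  proof (rule sum.reindex_bij_witness[where i = "\<lambda>\<sigma>. ?t \<circ> \<sigma> \<circ> ?t" and j = "\<lambda>\<sigma>. ?t \<circ> \<sigma> \<circ> ?t"])
    fix \<sigma> assume \<sigma>: "\<sigma> \<in> {\<sigma>. \<sigma> permutes {..<r}}"
    show tt: "?t \<circ> (?t \<circ> \<sigma> \<circ> ?t) \<circ> ?t = \<sigma>" by (simp add: fun_eq_iff)
    show *: "?t \<circ> \<sigma> \<circ> ?t \<in> {\<sigma>. \<sigma> permutes {..<r}}" using \<sigma> t by (simp add: permutes_compose)
    have "perm_term m (permute_list ?t I) \<sigma> = perm_term m I (?t \<circ> \<sigma> \<circ> ?t)"
      using perm_term_transpose[of "?t \<circ> \<sigma> \<circ> ?t" I a b m] * swap.hyps len unfolding tt by simp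
    then show "asmul (of_int (irr_char r lam (?t \<circ> \<sigma> \<circ> ?t))) (perm_term m I (?t \<circ> \<sigma> \<circ> ?t)) =
        asmul (of_int (irr_char r lam \<sigma>)) (perm_term m (permute_list ?t I) \<sigma>)"
      using swap.hyps by (simp only: irr_char_conj lessThan_iff)
  qed (use t in \<open>auto simp: permutes_compose fun_eq_iff\<close>)
  also have "\<dots> = super_imm m n lam I" by (rule super_imm_eq[OF swap.prems, symmetric])
  finally show ?case .
qed simp

section \<open>Star powers and descending cycles\<close>

lemma idx_append:
  "bij_betw (\<lambda>(J1, J2). J1 @ J2) (idx N a \<times> idx N b) (idx N (a + b))"
  by (rule bij_betw_byWitness[where f' = "\<lambda>J. (take a J, drop a J)"])
     (auto simp: idx_def subset_iff dest: in_set_takeD in_set_dropD)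

lemma sum_idx_append: "(\<Sum>J\<in>idx N (a + b). g J) = (\<Sum>J1\<in>idx N a. \<Sum>J2\<in>idx N b. g (J1 @ J2))"
  by (simp add: sum.reindex_bij_betw[OF idx_append, symmetric] sum.cartesian_product case_prod_beta)

lemma sum_idx_1: "(\<Sum>J\<in>idx N (Suc 0). g J) = (\<Sum>i\<in>{1..N}. g [i])"
  by (rule sum.reindex_bij_witness[where i = "\<lambda>i. [i]" and j = hd]) (auto simp: idx_def length_Suc_conv)

lemma sum_idx_snoc: "(\<Sum>J\<in>idx N (Suc k). g J) = (\<Sum>L\<in>idx N k. \<Sum>i\<in>{1..N}. g (L @ [i]))"
  using sum_idx_append[of g N k 1] by (simp add: sum_idx_1)

lemma sum_idx_Cons: "(\<Sum>J\<in>idx N (Suc k). g J) = (\<Sum>i\<in>{1..N}. \<Sum>L\<in>idx N k. g (i # L))"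
  using sum_idx_append[of g N 1 k] by (simp add: sum_idx_1)

text \<open>Row \<open>[i, u]\<close> of \<open>P\<close> has its only entry in column
  \<open>[u, i]\<close>, so the trace index \<open>i\<close> becomes the index linking the two
  factors: the star product is a matrix product twisted by signs.\<close>

lemma star_Xmat:
  assumes uv: "u \<in> {1..m + n}" "v \<in> {1..m + n}" and fin: "\<And>i. fin_odd (Y u i)"
  shows "star m n Y (Xmat m) u v = (\<Sum>i\<in>{1..m + n}.
    asmul (sgnc ((par m u + par m i) * (par m i + par m v))) (amul (Y u i) (xgen m i v)))"
proof -
  define Y1 where "Y1 I J = (if I ! 1 = J ! 1 then Y (I ! 0) (J ! 0) else 0)" for I J :: "nat list"
  define Z2 where "Z2 I J = (if I ! 0 = J ! 0 then Xmat m (I ! 1) (J ! 1) else 0)" for I J :: "nat list"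
  define PY where "PY = tmul m n 2 (Pel m) Y1"
  have two: "{..<2} = {0, 1 :: nat}" by auto
  have sgn: "(\<Sum>p<2. \<Sum>q<p. f p q) = f 1 0" for f :: "nat \<Rightarrow> nat \<Rightarrow> nat"
    by (simp add: two)
  have entry: "tmul m n 2 PY Z2 [i, u] [i, v] =
      asmul (sgnc (par m i) * sgnc ((par m u + par m i) * (par m i + par m v))) (amul (Y u i) (xgen m i v))"
    if i: "i \<in> {1..m + n}" for i
  proof -
    have PY_entry: "PY [i, u] J = asmul (sgnc ((par m u + par m i) * (par m u + par m (J ! 0)) + par m u))
        (if J ! 1 = i then Y u (J ! 0) else 0)" for J
    proof -
      have mem: "[u, i] \<in> idx (m + n) 2" using uv i by (auto simp: idx_def)
      have "Pel m [i, u] K = 0" if "K \<in> idx (m + n) 2 - {[u, i]}" for K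
        using that by (auto simp: Pel_def)
      moreover have "Pel m [i, u] [u, i] = ascal (sgnc (par m u))" by (simp add: Pel_def)
      moreover have "even (edeg m [i, u] [u, i])" by (simp add: edeg_def two) blast
      ultimately show ?thesis
        unfolding PY_def tmul_def sgn
        by (subst sum.remove[OF finite_idx mem], subst sum.neutral)
           (auto simp: pinv_simps amul_ascal fin Y1_def sgnc_add)
    qed
    have mem: "[i, i] \<in> idx (m + n) 2" using i by (auto simp: idx_def)
    \<comment> \<open>\<open>PY\<close> forces the second entry of \<open>K\<close> to be
      \<open>i\<close>, and \<open>Z2\<close> the first.\<close>
    have zero: "amul (PY [i, u] K) (pinv d (Z2 K [i, v])) = 0" if "K \<in> idx (m + n) 2 - {[i, i]}" for K d
    proof -
      from that obtain a b where "K = [a, b]" "a \<noteq> i \<or> b \<noteq> i"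
        by (auto simp: idx_def length_Suc_conv numeral_2_eq_2)
      then show ?thesis by (auto simp: PY_entry Z2_def pinv_simps)
    qed
    have "sgnc (edeg m [i, u] [i, i] * (par m i + par m v)) = sgnc ((par m u + par m i) * (par m i + par m v))"
      by (rule sgnc_eqI) (auto simp: edeg_def two)
    \<comment> \<open>What remains of the signs from \<open>P\<close> and \<open>Y1\<close> cancels
      the sign of the partial supertrace.\<close>
    moreover have "sgnc ((par m u + par m i) * (par m u + par m i) + par m u) = sgnc (par m i)"
      by (rule sgnc_eqI) auto
    moreover have "tmul m n 2 PY Z2 [i, u] [i, v] =
        asmul (sgnc ((par m u + par m i) * (par m i + par m i)))
          (amul (PY [i, u] [i, i]) (pinv (edeg m [i, u] [i, i]) (Z2 [i, i] [i, v])))"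
      unfolding tmul_def sgn
      by (subst sum.remove[OF finite_idx mem], subst sum.neutral) (simp_all add: zero)
    moreover have "sgnc ((par m u + par m i) * (par m i + par m i)) = 1"
      by (rule sgnc_even) simp
    ultimately show ?thesis
      by (simp add: PY_entry Z2_def Xmat_def pinv_simps mult_ac)
  qed
  have "star m n Y (Xmat m) u v = (\<Sum>i\<in>{1..m + n}. asmul (sgnc (par m i)) (tmul m n 2 PY Z2 [i, u] [i, v]))"
    by (simp add: star_def Let_def PY_def Y1_def[abs_def] Z2_def[abs_def])
  also have "\<dots> = (\<Sum>i\<in>{1..m + n}.
      asmul (sgnc ((par m u + par m i) * (par m i + par m v))) (amul (Y u i) (xgen m i v)))"
    by (intro sum.cong refl) (simp only: entry asmul_simps sgnc_square)
  finally show ?thesis .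
qed

text \<open>The accumulated signs of \<open>k\<close> star products with \<open>X\<close>. The left
  factor always keeps the row at the start of the path, hence \<open>j 0\<close> in every
  summand.\<close>

definition path_sgn :: "nat \<Rightarrow> (nat \<Rightarrow> nat) \<Rightarrow> nat" where
  "path_sgn k j = (\<Sum>t<k. (j 0 + j (Suc t)) * (j (Suc t) + j (Suc (Suc t))))"

definition path_term :: "nat \<Rightarrow> nat \<Rightarrow> nat list \<Rightarrow> salg" where
  "path_term m k C = asmul (sgnc (path_sgn k (\<lambda>p. par m (C ! p))))
    (aprod (map (\<lambda>s. xgen m (C ! s) (C ! Suc s)) [0..<Suc k]))"

lemma fin_odd_path_term [simp]: "fin_odd (path_term m k C)"
  by (simp add: path_term_def del: upt_Suc)

lemma Xpow_eq_paths:
  assumes "u \<in> {1..m + n}" "v \<in> {1..m + n}"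
  shows "Xpow m n (Suc k) u v = (\<Sum>L\<in>idx (m + n) k. path_term m k (u # L @ [v]))"
  using assms(2)
proof (induction k arbitrary: v)
  case 0
  have "idx (m + n) 0 = {[]}" by (auto simp: idx_def)
  then show ?case by (simp add: Xmat_def path_term_def path_sgn_def aprod_singleton)
next
  case (Suc k)
  have fin: "fin_odd (Xpow m n (Suc k) u i)" for i
  proof -
    have "fin_odd (star m n Y Z a b)" for Y Z a b
      by (simp add: star_def Let_def tmul_def)
    then show ?thesis by (cases k) (simp_all add: Xmat_def)
  qed
  have step: "asmul (sgnc ((par m u + par m i) * (par m i + par m v)))
      (amul (path_term m k (u # L @ [i])) (xgen m i v)) = path_term m (Suc k) (u # (L @ [i]) @ [v])"
    if "L \<in> idx (m + n) k" for L i
  proof -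
    let ?C = "u # L @ [i]" and ?D = "u # (L @ [i]) @ [v]"
    have len: "length L = k" using that by (rule idx_length)
    have nth: "?D ! p = ?C ! p" if "p \<le> Suc k" for p
      using that len nth_append[of ?C "[v]" p] by simp
    have ends: "?D ! Suc k = i" "?D ! Suc (Suc k) = v"
      using len by (simp_all add: nth_append)
    have "aprod (map (\<lambda>s. xgen m (?D ! s) (?D ! Suc s)) [0..<Suc (Suc k)]) =
        amul (aprod (map (\<lambda>s. xgen m (?C ! s) (?C ! Suc s)) [0..<Suc k])) (xgen m i v)"
    proof -
      have "map (\<lambda>s. xgen m (?D ! s) (?D ! Suc s)) [0..<Suc (Suc k)] =
          map (\<lambda>s. xgen m (?D ! s) (?D ! Suc s)) [0..<Suc k] @ [xgen m i v]"
        by (subst upt_Suc) (simp only: ends map_append list.map zero_le if_True)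
      also have "map (\<lambda>s. xgen m (?D ! s) (?D ! Suc s)) [0..<Suc k] = map (\<lambda>s. xgen m (?C ! s) (?C ! Suc s)) [0..<Suc k]"
        by (intro map_cong refl arg_cong2[of _ _ _ _ "xgen m"] nth) auto
      finally show ?thesis by (simp only: aprod_snoc)
    qed
    moreover have "path_sgn (Suc k) (\<lambda>p. par m (?D ! p)) =
        path_sgn k (\<lambda>p. par m (?C ! p)) + (par m u + par m i) * (par m i + par m v)"
    proof -
      have "(\<Sum>t<k. (par m (?D ! 0) + par m (?D ! Suc t)) * (par m (?D ! Suc t) + par m (?D ! Suc (Suc t)))) =
        (\<Sum>t<k. (par m (?C ! 0) + par m (?C ! Suc t)) * (par m (?C ! Suc t) + par m (?C ! Suc (Suc t))))"
        by (intro sum.cong refl) (simp only: nth lessThan_iff Suc_le_mono less_imp_le Suc_leI zero_le)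
      then show ?thesis
        unfolding path_sgn_def sum.lessThan_Suc ends by simp
    qed
    ultimately show ?thesis
      unfolding path_term_def by (simp only: sgnc_add amul_asmul asmul_simps mult.commute)
  qed
  have "Xpow m n (Suc (Suc k)) u v = (\<Sum>i\<in>{1..m + n}. \<Sum>L\<in>idx (m + n) k.
      asmul (sgnc ((par m u + par m i) * (par m i + par m v))) (amul (path_term m k (u # L @ [i])) (xgen m i v)))"
    unfolding Xpow.simps(3) star_Xmat[where Y = "Xpow m n (Suc k)", OF assms(1) Suc.prems fin]
    by (intro sum.cong refl) (simp only: Suc.IH amul_sum_left asmul_sum)
  also have "\<dots> = (\<Sum>L\<in>idx (m + n) k. \<Sum>i\<in>{1..m + n}. path_term m (Suc k) (u # (L @ [i]) @ [v]))"
    by (subst sum.swap, intro sum.cong refl) (rule step)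
  also have "\<dots> = (\<Sum>L\<in>idx (m + n) (Suc k). path_term m (Suc k) (u # L @ [v]))"
    by (simp only: sum_idx_snoc)
  finally show ?case .
qed

text \<open>Its inverse advances each position by one and closes up at \<open>k\<close>, so
  \<open>perm_term\<close> reads the generators along a closed path.\<close>

definition desc_cycle :: "nat \<Rightarrow> nat \<Rightarrow> nat" where
  "desc_cycle k p = (if p = 0 then k else if p \<le> k then p - 1 else p)"

lemma desc_cycle_permutes: "desc_cycle k permutes {..<Suc k}"
  and inv_desc_cycle: "inv (desc_cycle k) p = (if p < k then Suc p else if p = k then 0 else p)"
proof -
  define g where "g p = (if p < k then Suc p else if p = k then 0 else p)" for p
  have *: "desc_cycle k (g p) = p" "g (desc_cycle k p) = p" for p
    by (auto simp: desc_cycle_def g_def)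
  have "bij (desc_cycle k)" by (rule bijI'[of _]) (metis *, metis *)
  then show "desc_cycle k permutes {..<Suc k}"
    unfolding permutes_def bij_iff by (simp add: desc_cycle_def)
  show "inv (desc_cycle k) p = (if p < k then Suc p else if p = k then 0 else p)"
    using * inv_equality[of g "desc_cycle k"] by (simp add: g_def)
qed

lemma perm_term_desc_cycle:
  assumes "length L = k"
  shows "perm_term m (u # L) (desc_cycle k) = asmul (sgnc (par m u)) (path_term m k (u # L @ [u]))"
proof -
  let ?J = "u # L" and ?C = "u # L @ [u]" and ?g = "inv (desc_cycle k)"
  define j where "j p = par m (?C ! p)" for p
  have C: "?C ! p = ?J ! p" if "p \<le> k" for p
    using that assms nth_append[of ?J "[u]" p] by simp
  have C_last: "?C ! Suc k = u" using assms by (simp add: nth_append)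
  have g: "?J ! ?g p = ?C ! Suc p" "?g p \<le> k" if "p < Suc k" for p
    using that C[of "Suc p"] C_last by (cases "p = k"; simp add: inv_desc_cycle)+
  have "aprod (map (\<lambda>p. xgen m (?J ! p) (?J ! ?g p)) [0..<Suc k]) =
      aprod (map (\<lambda>s. xgen m (?C ! s) (?C ! Suc s)) [0..<Suc k])"
    by (intro arg_cong[of _ _ aprod] map_cong refl) (simp only: g C set_upt atLeastLessThan_iff less_Suc_eq_le)
  moreover have "sgnc (ordsgn (Suc k) (\<lambda>p. par m (?J ! p)) (desc_cycle k)) = sgnc (par m u + path_sgn k j)"
  proof (rule sgnc_eqI)
    have "ordsgn (Suc k) (\<lambda>p. par m (?J ! p)) (desc_cycle k) = ordsgn (Suc k) j (desc_cycle k)"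
      by (rule ordsgn_cong[OF _ desc_cycle_permutes]) (simp only: j_def C less_Suc_eq_le)
    moreover have "tri (Suc k) (\<lambda>p q. (j (?g p) + j p) * j q) = (\<Sum>p<Suc k. (j p + j (Suc p)) * (\<Sum>q<p. j q))"
    proof -
      have "j (?g p) = j (Suc p)" if "p < Suc k" for p
        using g[OF that] C[of "?g p"] by (simp only: j_def)
      then show ?thesis unfolding tri_def sum_distrib_left
        by (intro sum.cong refl) (simp only: lessThan_iff add.commute)
    qed
    \<comment> \<open>Position 0 goes to the top and the others keep their order, so the inversions
      are the pairs with \<open>q = 0\<close>.\<close>
    moreover have "tri (Suc k) (\<lambda>p q. if desc_cycle k p < desc_cycle k q then j p * j q else 0) =
        j 0 * (\<Sum>q<k. j (Suc q))"
    proof -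
      have "(\<Sum>q<Suc p. if desc_cycle k (Suc p) < desc_cycle k q then j (Suc p) * j q else 0) = j 0 * j (Suc p)"
        if "p < k" for p
        using that by (subst sum.lessThan_Suc_shift) (simp add: desc_cycle_def)
      then show ?thesis
        unfolding tri_def by (subst sum.lessThan_Suc_shift) (simp add: sum_distrib_left)
    qed
    ultimately have ord: "ordsgn (Suc k) (\<lambda>p. par m (?J ! p)) (desc_cycle k) =
        (\<Sum>p<Suc k. j p) + (\<Sum>p<Suc k. (j p + j (Suc p)) * (\<Sum>q<p. j q)) + j 0 * (\<Sum>q<k. j (Suc q))"
      by (simp only: ordsgn_def)
    have j0: "par m u = j 0" "j (Suc k) = j 0" unfolding j_def C_last by simp_all
    \<comment> \<open>The closing terms of \<open>block_sign\<close> are even on a closed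
      path.\<close>
    have "even (A + B)" if "even (A + B + (d + d) * S + d + d * d)" for A B d S :: nat
      using that by auto
    from this[OF block_sign[where k = k and j = j, unfolded j0(2)]]
    show "even (ordsgn (Suc k) (\<lambda>p. par m (?J ! p)) (desc_cycle k) + (par m u + path_sgn k j))"
      unfolding ord j0(1) path_sgn_def .
  qed
  moreover have "length ?J = Suc k" using assms by simp
  ultimately show ?thesis
    unfolding perm_term_def path_term_def by (simp only: sgnc_add asmul_simps j_def[abs_def])
qed

text \<open>The trace index is the first entry of the tuple, and the inner vertices of the closed
  path are the rest.\<close>

lemma gamma_eq_cycle_sum: "gamma m n (Suc k) = cycle_sum m n (Suc k) (desc_cycle k)"
  unfolding gamma_def cycle_sum_def sum_idx_Cons
proof (intro sum.cong refl)
  fix u assume "u \<in> {1..m + n}"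
  then have "Xpow m n (Suc k) u u = (\<Sum>L\<in>idx (m + n) k. path_term m k (u # L @ [u]))"
    by (rule Xpow_eq_paths) fact
  then show "asmul (sgnc (par m u)) (Xpow m n (Suc k) u u) =
      (\<Sum>L\<in>idx (m + n) k. perm_term m (u # L) (desc_cycle k))"
    by (simp only: asmul_sum perm_term_desc_cycle idx_length cong: sum.cong)
qed

section \<open>Splitting off the last block\<close>

lemma sum_nat_lessThan_add: "(\<Sum>p<a + b. g p) = (\<Sum>p<a. g p) + (\<Sum>p<b. g (a + p :: nat) :: nat)"
  by (induction b) (simp_all add: add.assoc)

lemma tri_add:
  "tri (a + b) f = tri a f + tri b (\<lambda>p q. f (a + p) (a + q)) + (\<Sum>p<b. \<Sum>q<a. f (a + p) q)"
  by (simp add: tri_def sum_nat_lessThan_add sum.distrib)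

text \<open>The inductive situation: the final \<open>Suc k\<close> positions form one descending
  cycle, and \<open>init\<close> is what precedes it.\<close>

locale last_block =
  fixes \<sigma> :: "nat \<Rightarrow> nat" and a k :: nat
  assumes perm: "\<sigma> permutes {..<a + Suc k}"
    and block: "\<And>s. s < Suc k \<Longrightarrow> \<sigma> (a + s) = a + desc_cycle k s"
begin

definition init :: "nat \<Rightarrow> nat" where
  "init p = (if p < a then \<sigma> p else p)"

lemma inv_block: "s < Suc k \<Longrightarrow> inv \<sigma> (a + s) = a + inv (desc_cycle k) s"
  using block[of "inv (desc_cycle k) s"] permutes_less[OF permutes_inv[OF desc_cycle_permutes], of k s]
  by (metis permutes_inverses(1)[OF desc_cycle_permutes] permutes_inverses(2)[OF perm])

text \<open>A value in the block already has its preimage there, by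
  \<open>inv_block\<close>.\<close>

lemma less_init: "p < a \<Longrightarrow> \<sigma> p < a"
proof (rule ccontr)
  assume p: "p < a" "\<not> \<sigma> p < a"
  then have "\<sigma> p < a + Suc k" using permutes_less[OF perm, of p] by simp
  then have "inv \<sigma> (\<sigma> p) = a + inv (desc_cycle k) (\<sigma> p - a)"
    using inv_block[of "\<sigma> p - a"] p(2) by simp
  then show False using p(1) by (simp add: permutes_inverses[OF perm])
qed

lemma init_permutes: "init permutes {..<a}"
proof (rule bij_imp_permutes)
  have "inj_on init {..<a}"
    using permutes_inj[OF perm] by (auto simp: inj_on_def init_def dest: injD)
  moreover have "init ` {..<a} \<subseteq> {..<a}" using less_init by (auto simp: init_def)
  ultimately show "bij_betw init {..<a} {..<a}"
    by (simp add: bij_betw_def endo_inj_surj)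
qed (simp add: init_def)

lemma inv_init: "p < a \<Longrightarrow> inv init p = inv \<sigma> p"
proof -
  assume "p < a"
  then have "inv init p < a" using permutes_less[OF permutes_inv[OF init_permutes]] by simp
  then have "\<sigma> (inv init p) = p"
    using permutes_inverses(1)[OF init_permutes, of p] by (simp add: init_def)
  then show ?thesis by (metis permutes_inverses(2)[OF perm])
qed

lemma upt_split: "[0..<a + Suc k] = [0..<a] @ map (\<lambda>s. a + s) [0..<Suc k]"
  using upt_add_eq_append[of 0 a "Suc k"] map_add_upt[of a "Suc k"] by (simp add: add.commute del: upt_Suc)

text \<open>The monomial splits by position; the work lies in showing that the mixed part of the
  exponent is even.\<close>

lemma perm_term_append:
  assumes len: "length J1 = a" "length J2 = Suc k"
  shows "perm_term m (J1 @ J2) \<sigma> = amul (perm_term m J1 init) (perm_term m J2 (desc_cycle k))"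
proof -
  let ?J = "J1 @ J2" and ?c = "desc_cycle k"
  let ?j = "\<lambda>p. par m (?J ! p)" and ?j1 = "\<lambda>p. par m (J1 ! p)" and ?j2 = "\<lambda>p. par m (J2 ! p)"
  have J1: "?J ! p = J1 ! p" if "p < a" for p using that len by (simp add: nth_append)
  have J2: "?J ! (a + s) = J2 ! s" for s using len by (simp add: nth_append)
  have inv1: "?J ! inv \<sigma> p = J1 ! inv init p" if "p < a" for p
    using that J1[of "inv init p"] permutes_less[OF permutes_inv[OF init_permutes], of p] by (simp add: inv_init)
  have inv2: "?J ! inv \<sigma> (a + s) = J2 ! inv ?c s" if "s < Suc k" for s
    using that by (simp add: inv_block J2)
  have "map (\<lambda>p. xgen m (?J ! p) (?J ! inv \<sigma> p)) [0..<a + Suc k] =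
      map (\<lambda>p. xgen m (J1 ! p) (J1 ! inv init p)) [0..<a] @ map (\<lambda>p. xgen m (J2 ! p) (J2 ! inv ?c p)) [0..<Suc k]"
    unfolding upt_split map_append map_map
    by (intro arg_cong2[of _ _ _ _ "(@)"] map_cong refl)
       (simp_all only: J1 inv1 J2 inv2 o_apply set_upt atLeastLessThan_iff)
  then have prod: "aprod (map (\<lambda>p. xgen m (?J ! p) (?J ! inv \<sigma> p)) [0..<length ?J]) =
      amul (aprod (map (\<lambda>p. xgen m (J1 ! p) (J1 ! inv init p)) [0..<length J1]))
        (aprod (map (\<lambda>p. xgen m (J2 ! p) (J2 ! inv ?c p)) [0..<length J2]))"
    unfolding length_append len by (simp only: aprod_append)
  have "sgnc (ordsgn (a + Suc k) ?j \<sigma>) = sgnc (ordsgn a ?j1 init + ordsgn (Suc k) ?j2 ?c)"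
  proof (rule sgnc_eqI)
    let ?f = "\<lambda>p q. (?j (inv \<sigma> p) + ?j p) * ?j q" and ?h = "\<lambda>p q. if \<sigma> p < \<sigma> q then ?j p * ?j q else 0"
    have "(\<Sum>p<a + Suc k. ?j p) = (\<Sum>p<a. ?j1 p) + (\<Sum>p<Suc k. ?j2 p)"
      unfolding sum_nat_lessThan_add J2 by (intro arg_cong2[of _ _ _ _ "(+)"] sum.cong refl) (simp add: J1)
    moreover have "tri a ?f = tri a (\<lambda>p q. (?j1 (inv init p) + ?j1 p) * ?j1 q)"
      by (rule tri_cong) (simp add: J1 inv1)
    moreover have "tri (Suc k) (\<lambda>p q. ?f (a + p) (a + q)) = tri (Suc k) (\<lambda>p q. (?j2 (inv ?c p) + ?j2 p) * ?j2 q)"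
      by (rule tri_cong) (simp only: J2 inv2)
    moreover have "tri a ?h = tri a (\<lambda>p q. if init p < init q then ?j1 p * ?j1 q else 0)"
      by (rule tri_cong) (simp add: J1 init_def)
    moreover have "tri (Suc k) (\<lambda>p q. ?h (a + p) (a + q)) = tri (Suc k) (\<lambda>p q. if ?c p < ?c q then ?j2 p * ?j2 q else 0)"
      by (rule tri_cong) (simp add: J2 block)
    \<comment> \<open>Both parts are preserved, so no inversion crosses between them.\<close>
    moreover have "(\<Sum>p<Suc k. \<Sum>q<a. ?h (a + p) q) = 0"
    proof (intro sum.neutral ballI)
      fix p q assume "p \<in> {..<Suc k}" "q \<in> {..<a}"
      then show "?h (a + p) q = 0" using block[of p] less_init[of q] by simp
    qed
    \<comment> \<open>The row and column indices of the block are rearrangements of each other, so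
      their parities add up to an even number.\<close>
    moreover have "even (\<Sum>p<Suc k. \<Sum>q<a. ?f (a + p) q)"
    proof -
      have "(\<Sum>p<Suc k. \<Sum>q<a. ?f (a + p) q) = (\<Sum>p<Suc k. ?j2 (inv ?c p) + ?j2 p) * (\<Sum>q<a. ?j q)"
        unfolding sum_product
        by (intro sum.cong refl) (simp only: J2 inv2 lessThan_iff)
      moreover have "(\<Sum>p<Suc k. ?j2 (inv ?c p)) = (\<Sum>p<Suc k. ?j2 p)"
        using sum.permute[OF permutes_inv[OF desc_cycle_permutes[of k]], of ?j2] by (simp only: o_def)
      ultimately show ?thesis by (simp only: sum.distrib even_mult_iff even_add simp_thms)
    qed
    ultimately show "even (ordsgn (a + Suc k) ?j \<sigma> + (ordsgn a ?j1 init + ordsgn (Suc k) ?j2 ?c))"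
      unfolding ordsgn_def tri_add by (simp only: even_add even_zero simp_thms) blast
  qed
  then show ?thesis
    unfolding perm_term_def amul_asmul prod asmul_simps
    by (simp only: length_append len sgnc_add mult.commute)
qed

lemma cycle_sum_append:
  "cycle_sum m n (a + Suc k) \<sigma> = amul (cycle_sum m n a init) (gamma m n (Suc k))"
  unfolding gamma_eq_cycle_sum cycle_sum_def sum_idx_append amul_sum_left amul_sum_right
  by (subst sum.swap, intro sum.cong refl perm_term_append) (auto simp: idx_length)

lemma fin_odd_gamma: "fin_odd (gamma m n (Suc k))"
  by (simp add: gamma_eq_cycle_sum cycle_sum_def)

text \<open>The inverse climbs through the block: rows \<open>a + s\<close> with
  \<open>s < k\<close> meet the superdiagonal entries \<open>a + Suc s\<close>, and the last row
  meets column \<open>a\<close>, whose entry is \<open>gamma m n (Suc k)\<close>.\<close>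

lemma Gam_prod_append:
  "aprod (map (\<lambda>i. Gam m n i (inv \<sigma> i)) [0..<a + Suc k]) =
    amul (aprod (map (\<lambda>i. Gam m n i (inv init i)) [0..<a]))
      (asmul (of_nat (\<Prod>s<k. a + Suc s)) (gamma m n (Suc k)))"
proof -
  have scal: "aprod (map (\<lambda>s. Gam m n (a + s) (inv \<sigma> (a + s))) [0..<l]) = asmul (of_nat (\<Prod>s<l. a + Suc s)) (ascal 1)"
    if "l \<le> k" for l
    using that
  proof (induction l)
    case (Suc l)
    have "Gam m n (a + l) (inv \<sigma> (a + l)) = asmul (of_nat (a + Suc l)) (ascal 1)"
      using Suc.prems inv_block[of l] ascal_eq_asmul[of "of_nat (a + Suc l)"] by (simp add: inv_desc_cycle Gam_def)
    moreover have "aprod (map (\<lambda>s. Gam m n (a + s) (inv \<sigma> (a + s))) [0..<l]) =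
        asmul (of_nat (\<Prod>s<l. a + Suc s)) (ascal 1)"
      using Suc by simp
    ultimately show ?case
      by (simp only: upt_Suc le0 if_True map_append list.map aprod_snoc amul_asmul asmul_simps
          amul_ascal_left fin_odd_intros prod.lessThan_Suc of_nat_mult mult.commute)
  qed simp
  have "inv \<sigma> (a + k) = a" using inv_block[of k] by (simp add: inv_desc_cycle)
  then have "Gam m n (a + k) (inv \<sigma> (a + k)) = gamma m n (Suc k)" by (simp add: Gam_def)
  then have "aprod (map (\<lambda>s. Gam m n (a + s) (inv \<sigma> (a + s))) [0..<Suc k]) =
      asmul (of_nat (\<Prod>s<k. a + Suc s)) (gamma m n (Suc k))"
    by (simp add: aprod_snoc scal amul_ascal_left fin_odd_gamma)
  moreover have "map (\<lambda>i. Gam m n i (inv \<sigma> i)) [0..<a + Suc k] =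
      map (\<lambda>i. Gam m n i (inv init i)) [0..<a] @ map (\<lambda>s. Gam m n (a + s) (inv \<sigma> (a + s))) [0..<Suc k]"
    unfolding upt_split map_append map_map by (simp add: inv_init o_def del: upt_Suc)
  ultimately show ?thesis by (simp only: aprod_append)
qed

text \<open>Within the block \<open>\<sigma>\<close> descends everywhere except at \<open>a\<close>.
  The weights of these positions are the superdiagonal entries met in
  \<open>Gam_prod_append\<close>.\<close>

lemma weight_append:
  "(\<Prod>i | i < a + Suc k \<and> \<sigma> i < i. i) = (\<Prod>i | i < a \<and> init i < i. i) * (\<Prod>s<k. a + Suc s)"
proof -
  have eq: "{i. i < a + Suc k \<and> \<sigma> i < i} = {i. i < a \<and> init i < i} \<union> (\<lambda>s. a + Suc s) ` {..<k}"
  proof (intro equalityI subsetI)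
    fix i assume i: "i \<in> {i. i < a + Suc k \<and> \<sigma> i < i}"
    show "i \<in> {i. i < a \<and> init i < i} \<union> (\<lambda>s. a + Suc s) ` {..<k}"
    proof (cases "i < a")
      case False
      then obtain s where s: "i = a + s" by (metis le_Suc_ex not_less)
      with i block[of s] have "s \<noteq> 0" "s < Suc k" by (auto simp: desc_cycle_def)
      then have "i = a + Suc (s - 1)" "s - 1 < k" using s by auto
      then show ?thesis by blast
    qed (use i in \<open>simp add: init_def\<close>)
  next
    fix i assume "i \<in> {i. i < a \<and> init i < i} \<union> (\<lambda>s. a + Suc s) ` {..<k}"
    then show "i \<in> {i. i < a + Suc k \<and> \<sigma> i < i}"
    proof
      assume "i \<in> (\<lambda>s. a + Suc s) ` {..<k}"
      then obtain s where "s < k" "i = a + Suc s" by auto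
      then show ?thesis using block[of "Suc s"] by (simp add: desc_cycle_def)
    qed (auto simp: init_def)
  qed
  show ?thesis
    unfolding eq by (subst prod.union_disjoint) (auto simp: prod.reindex inj_on_def)
qed

end

text \<open>The block starts at the preimage \<open>a\<close> of \<open>r\<close>, and every later
  position steps down by one. If instead \<open>\<sigma> p \<ge> p\<close>, the position after
  \<open>\<sigma> p\<close> is still at most \<open>r\<close> and, by induction from the top,
  already takes the value \<open>\<sigma> p\<close>.\<close>

lemma hessenberg_last_block:
  assumes \<sigma>: "\<sigma> permutes {..<Suc r}" and H: "\<forall>i<Suc r. i \<le> Suc (\<sigma> i)"
  obtains a k where "a + k = r" "last_block \<sigma> a k"
proof
  define a where "a = inv \<sigma> r"
  define k where "k = r - a"
  have \<sigma>a: "\<sigma> a = r" by (simp add: a_def permutes_inverses[OF \<sigma>])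
  then have ar: "a \<le> r" using permutes_less[OF \<sigma>, of a] by simp
  then show ak: "a + k = r" by (simp add: k_def)
  have inj: "\<sigma> x = \<sigma> y \<longleftrightarrow> x = y" for x y using permutes_inj[OF \<sigma>] by (auto dest: injD)
  have down: "\<sigma> p = p - 1" if "a < p" "p \<le> r" for p
    using that
  proof (induction "r - p" arbitrary: p rule: less_induct)
    case less
    show ?case
    proof (rule ccontr)
      assume "\<sigma> p \<noteq> p - 1"
      moreover have "p \<le> Suc (\<sigma> p)" using H less.prems by simp
      ultimately have ge: "p \<le> \<sigma> p" by linarith
      have "\<sigma> p \<noteq> r" using \<sigma>a inj[of p a] less.prems by auto
      moreover have "\<sigma> p < Suc r" using permutes_less[OF \<sigma>, of p] less.prems by simp
      ultimately have lt: "Suc (\<sigma> p) \<le> r" by simp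
      then have "\<sigma> (Suc (\<sigma> p)) = Suc (\<sigma> p) - 1"
        using ge less.prems by (intro less.hyps) auto
      then show False using inj[of "Suc (\<sigma> p)" p] ge by simp
    qed
  qed
  show "last_block \<sigma> a k"
  proof
    show "\<sigma> permutes {..<a + Suc k}" using \<sigma> ak by simp
    fix s assume "s < Suc k"
    then show "\<sigma> (a + s) = a + desc_cycle k s"
      using down[of "a + s"] \<sigma>a ak by (cases "s = 0") (auto simp: desc_cycle_def)
  qed
qed

text \<open>The last block multiplies both sides on the right by the same \<open>gamma\<close> and
  the same scalar, so induction on \<open>r\<close> removes it without reordering any
  factors.\<close>

lemma hessenberg_Gam_prod:
  assumes "\<sigma> permutes {..<r}" "\<forall>i<r. i \<le> Suc (\<sigma> i)"
  shows "aprod (map (\<lambda>i. Gam m n i (inv \<sigma> i)) [0..<r]) =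
    asmul (of_nat (\<Prod>i | i < r \<and> \<sigma> i < i. i)) (cycle_sum m n r \<sigma>)"
  using assms
proof (induction r arbitrary: \<sigma> rule: less_induct)
  case (less r)
  show ?case
  proof (cases r)
    case 0
    have "idx (m + n) 0 = {[]}" by (auto simp: idx_def)
    then show ?thesis by (simp add: 0 cycle_sum_def perm_term_def ordsgn_def tri_def)
  next
    case (Suc r')
    obtain a k where ak: "a + k = r'" "last_block \<sigma> a k"
      using hessenberg_last_block less.prems unfolding Suc by metis
    interpret last_block \<sigma> a k by (rule ak)
    have r: "r = a + Suc k" using ak Suc by simp
    have "aprod (map (\<lambda>i. Gam m n i (inv init i)) [0..<a]) =
        asmul (of_nat (\<Prod>i | i < a \<and> init i < i. i)) (cycle_sum m n a init)"
      using less.prems by (intro less.IH init_permutes) (simp_all add: r init_def)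
    then show ?thesis
      unfolding r Gam_prod_append weight_append cycle_sum_append by (simp add: mult.commute)
  qed
qed

section \<open>The classical immanant as a sum of supertraces\<close>

lemma aprod_zero: "0 \<in> set xs \<Longrightarrow> aprod xs = 0"
  by (induction xs rule: rev_induct) (auto simp: aprod_snoc)

lemma class_imm_Gam:
  "class_imm r lam (Gam m n) =
    (\<Sum>\<sigma> | \<sigma> permutes {..<r}. asmul (of_int (irr_char r lam \<sigma>)) (cycle_sum m n r \<sigma>))"
proof -
  let ?S = "{\<sigma>. \<sigma> permutes {..<r}}" and ?H = "{\<sigma>. \<sigma> permutes {..<r} \<and> (\<forall>i<r. i \<le> Suc (\<sigma> i))}"
  let ?\<chi> = "\<lambda>\<sigma>. of_int (irr_char r lam \<sigma>) :: complex"
  let ?G = "\<lambda>\<sigma>. aprod (map (\<lambda>i. Gam m n i (inv \<sigma> i)) [0..<r])"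
  let ?w = "\<lambda>\<sigma>. of_nat (\<Prod>i | i < r \<and> \<sigma> i < i. i) :: complex"
  have "class_imm r lam (Gam m n) = (\<Sum>\<sigma>\<in>?S. asmul (?\<chi> \<sigma>) (aprod (map (\<lambda>i. Gam m n i (\<sigma> i)) [0..<r])))"
    by (simp only: class_imm_def aprod_def atLeast0LessThan)
  \<comment> \<open>Inversion turns the support condition of \<open>Gam\<close>, that the value at
    \<open>i\<close> is at most \<open>i + 1\<close>, into the condition of
    \<open>sum_permutes_hessenberg\<close>.\<close>
  also have "\<dots> = (\<Sum>\<sigma>\<in>?S. asmul (?\<chi> \<sigma>) (?G \<sigma>))"
    by (rule sum.reindex_bij_witness[where i = inv and j = inv])
       (auto simp: permutes_inv permutes_inv_inv irr_char_inv)
  also have "\<dots> = (\<Sum>\<sigma>\<in>?H. asmul (?\<chi> \<sigma>) (?G \<sigma>))"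
  proof (rule sum.mono_neutral_right)
    show "\<forall>\<sigma>\<in>?S - ?H. asmul (?\<chi> \<sigma>) (?G \<sigma>) = 0"
    proof
      fix \<sigma> assume "\<sigma> \<in> ?S - ?H"
      then obtain p where \<sigma>: "\<sigma> permutes {..<r}" and p: "p < r" "Suc (\<sigma> p) < p" by (auto simp: not_le)
      \<comment> \<open>Row \<open>\<sigma> p\<close> meets column \<open>p\<close>, which lies
        beyond the superdiagonal.\<close>
      have "Gam m n (\<sigma> p) (inv \<sigma> (\<sigma> p)) = 0"
        using p by (simp add: Gam_def permutes_inverses[OF \<sigma>])
      moreover have "\<sigma> p < r" using permutes_less[OF \<sigma>] p by simp
      ultimately have "0 \<in> set (map (\<lambda>i. Gam m n i (inv \<sigma> i)) [0..<r])"
        by (auto intro!: image_eqI[of _ _ "\<sigma> p"])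
      then show "asmul (?\<chi> \<sigma>) (?G \<sigma>) = 0" by (simp only: aprod_zero asmul_simps)
    qed
  qed (auto simp: finite_permutations)
  also have "\<dots> = (\<Sum>\<sigma>\<in>?H. asmul (?w \<sigma> * ?\<chi> \<sigma>) (cycle_sum m n r \<sigma>))"
    by (intro sum.cong refl) (simp add: hessenberg_Gam_prod mult.commute)
  \<comment> \<open>\<open>sum_permutes_hessenberg\<close> takes values in a commutative semiring,
    so it is applied to the coefficient at each monomial \<open>M\<close>.\<close>
  also have "\<dots> = (\<Sum>\<sigma>\<in>?S. asmul (?\<chi> \<sigma>) (cycle_sum m n r \<sigma>))"
  proof
    fix M
    show "(\<Sum>\<sigma>\<in>?H. asmul (?w \<sigma> * ?\<chi> \<sigma>) (cycle_sum m n r \<sigma>)) M =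
        (\<Sum>\<sigma>\<in>?S. asmul (?\<chi> \<sigma>) (cycle_sum m n r \<sigma>)) M"
      using sum_permutes_hessenberg[of r "\<lambda>\<sigma>. ?\<chi> \<sigma> * cycle_sum m n r \<sigma> M"]
      by (simp only: sum_salg_apply asmul_apply mult.assoc irr_char_conj cycle_sum_conj)
  qed
  finally show ?thesis .
qed

theorem theorem3p11:
  fixes m n r :: nat and lam :: "nat list"
  assumes "1 \<le> r" and "is_partition lam r"
  shows "(\<Sum>I | I \<in> idx (m + n) r \<and> sorted I. asmul (1 / of_nat (alpha I)) (super_imm m n lam I))
         = asmul (1 / of_nat (fact r)) (class_imm r lam (Gam m n))"
proof -
  let ?S = "{\<sigma>. \<sigma> permutes {..<r}}"
  have "(\<Sum>I\<in>idx (m + n) r. super_imm m n lam I) =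
      (\<Sum>I\<in>idx (m + n) r. \<Sum>\<sigma>\<in>?S. asmul (of_int (irr_char r lam \<sigma>)) (perm_term m I \<sigma>))"
    by (intro sum.cong refl super_imm_eq)
  also have "\<dots> = (\<Sum>\<sigma>\<in>?S. asmul (of_int (irr_char r lam \<sigma>)) (cycle_sum m n r \<sigma>))"
    unfolding cycle_sum_def asmul_sum by (rule sum.swap)
  finally show ?thesis
    by (simp only: sum_sorted_lists[OF super_imm_symmetric] class_imm_Gam)
qed

end
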